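(* Let $R$ be a right hereditary or right perfect ring and let $\mathcal{T}\subseteq\mathrm{Mod}\text{-}R$ be a torsion class. The following are equivalent: (1) $\mathcal{T}=\mathrm{Gen}(T)$ for a minimal silting module $T$; (2) there exists a $\mathcal{T}$-envelope $\epsilon:R\to M$ of the regular module $R$. In particular, every enveloping torsion class in $\mathrm{Mod}\text{-}R$, for $R$ right hereditary or right perfect, is of the form $\mathrm{Gen}(T)$ for some silting module $T$.
   Context: All modules are right modules over a unital ring $R$; $\mathrm{Mod}\text{-}R$ is the category of right $R$-modules. $R$ is right hereditary if submodules of projective right $R$-modules are projective, and right perfect if every right $R$-module has a projective cover. For a module $T$, $\mathrm{Gen}(T)$ is the class of all modules that are epimorphic images of direct sums of copies of $T$. For a homomorphism $\sigma:P_{-1}\to P_0$ between projective modules, $\mathcal{D}_\sigma=\{X\in\mathrm{Mod}\text{-}R\mid \mathrm{Hom}_R(\sigma,X)\text{ is an epimorphism}\}$. A torsion class is a class of modules closed under isomorphic images, epimorphic images, direct sums and extensions. A module $T$ is silting if there is a projective presentation $P_{-1}\xrightarrow{\sigma}P_0\to T\to 0$ (exact, with $P_{-1},P_0$ projective) such that $\mathcal{D}_\sigma$ is a torsion class, $T\in\mathcal{D}_\sigma$, and $\mathcal{D}_\sigma=\mathrm{Gen}(T)$. A silting module $T$ is minimal if the regular module $R$ has a $\mathrm{Gen}(T)$-envelope. A homomorphism $\epsilon:X\to T$ with $T\in\mathcal{T}$ is a $\mathcal{T}$-preenvelope of $X$ if every homomorphism $X\to T'$ with $T'\in\mathcal{T}$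 factors through $\epsilon$; it is a $\mathcal{T}$-envelope if moreover every $\alpha:T\to T$ with $\alpha\epsilon=\epsilon$ is an isomorphism. $\mathcal{T}$ is enveloping if every module has a $\mathcal{T}$-envelope. *)

theory Defs
  imports "HOL-Algebra.Module" "HOL-Algebra.AbelCoset"
begin

(* Mod-R is a proper class, so it is taken relative to an arbitrary universe: a collection U of
   "small" subsets of an arbitrary type. The closure conditions below make the small modules
   closed under submodules, quotients, finite products, extensions and small direct sums.
   Examples: all subsets of an infinite type; the subsets of a type of cardinality k that have
   cardinality < k, for an inaccessible cardinal k (the sets of a Grothendieck universe); over a
   type of all ZFC sets, the subclasses that are sets. *)

locale universe =
  fixes U :: "'u set set"
  assumes subset_closed: "\<lbrakk>A \<in> U; B \<subseteq> A\<rbrakk> \<Longrightarrow> B \<in> U"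
    and image_closed: "A \<in> U \<Longrightarrow> (f :: 'u \<Rightarrow> 'u) ` A \<in> U"
    and Union_closed: "\<lbrakk>(I :: 'u set) \<in> U; \<And>i. i \<in> I \<Longrightarrow> F i \<in> U\<rbrakk> \<Longrightarrow> (\<Union>i\<in>I. F i) \<in> U"
    and infinity: "\<exists>A\<in>U. infinite A"

lemma universe_UNIV: "infinite (UNIV :: 'u set) \<Longrightarrow> universe (UNIV :: 'u set set)"
  by unfold_locales auto

(* The library's module records are used with a \<odot>\<^bsub>M\<^esub> x standing for the right action x a,
   whence the order of the factors in smult_assoc. The ring multiplication and unit fields of
   these records carry no meaning. *)
locale right_module = R?: ring R + M?: abelian_group M
  for R :: "('r, 'x) ring_scheme" (structure) and M :: "('r, 'm) module" (structure) +
  assumes smult_closed: "\<lbrakk>a \<in> carrier R; x \<in> carrier M\<rbrakk> \<Longrightarrow> a \<odot>\<^bsub>M\<^esub> x \<in> carrier M"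
    and smult_l_distr: "\<lbrakk>a \<in> carrier R; b \<in> carrier R; x \<in> carrier M\<rbrakk> \<Longrightarrow>
      (a \<oplus>\<^bsub>R\<^esub> b) \<odot>\<^bsub>M\<^esub> x = a \<odot>\<^bsub>M\<^esub> x \<oplus>\<^bsub>M\<^esub> b \<odot>\<^bsub>M\<^esub> x"
    and smult_r_distr: "\<lbrakk>a \<in> carrier R; x \<in> carrier M; y \<in> carrier M\<rbrakk> \<Longrightarrow>
      a \<odot>\<^bsub>M\<^esub> (x \<oplus>\<^bsub>M\<^esub> y) = a \<odot>\<^bsub>M\<^esub> x \<oplus>\<^bsub>M\<^esub> a \<odot>\<^bsub>M\<^esub> y"
    and smult_assoc: "\<lbrakk>a \<in> carrier R; b \<in> carrier R; x \<in> carrier M\<rbrakk> \<Longrightarrow>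
      (a \<otimes>\<^bsub>R\<^esub> b) \<odot>\<^bsub>M\<^esub> x = b \<odot>\<^bsub>M\<^esub> (a \<odot>\<^bsub>M\<^esub> x)"
    and smult_one: "x \<in> carrier M \<Longrightarrow> \<one>\<^bsub>R\<^esub> \<odot>\<^bsub>M\<^esub> x = x"

definition right_modules :: "('r, 'x) ring_scheme \<Rightarrow> 'u set set \<Rightarrow> ('r, 'u) module set" where
  "right_modules R U = {M. right_module R M \<and> carrier M \<in> U}"

definition regular_module :: "('r, 'x) ring_scheme \<Rightarrow> ('r, 'r) module" where
  "regular_module R = \<lparr>carrier = carrier R, mult = mult R, one = one R, zero = zero R,
     add = add R, smult = (\<lambda>a x. x \<otimes>\<^bsub>R\<^esub> a)\<rparr>"

(* Homomorphisms are extensional functions, so that equality of homomorphisms is equality of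
   functions; composites are formed with the library's compose. *)
definition Hom :: "('r, 'x) ring_scheme \<Rightarrow> ('r, 'm) module \<Rightarrow> ('r, 'n) module \<Rightarrow> ('m \<Rightarrow> 'n) set"
  where
  "Hom R M N = {f \<in> carrier M \<rightarrow>\<^sub>E carrier N.
     (\<forall>x\<in>carrier M. \<forall>y\<in>carrier M. f (x \<oplus>\<^bsub>M\<^esub> y) = f x \<oplus>\<^bsub>N\<^esub> f y) \<and>
     (\<forall>a\<in>carrier R. \<forall>x\<in>carrier M. f (a \<odot>\<^bsub>M\<^esub> x) = a \<odot>\<^bsub>N\<^esub> f x)}"

definition Epi :: "('r, 'x) ring_scheme \<Rightarrow> ('r, 'm) module \<Rightarrow> ('r, 'n) module \<Rightarrow> ('m \<Rightarrow> 'n) set"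
  where "Epi R M N = {f \<in> Hom R M N. f ` carrier M = carrier N}"

definition Iso :: "('r, 'x) ring_scheme \<Rightarrow> ('r, 'm) module \<Rightarrow> ('r, 'n) module \<Rightarrow> ('m \<Rightarrow> 'n) set"
  where "Iso R M N = {f \<in> Hom R M N. bij_betw f (carrier M) (carrier N)}"

definition direct_sum :: "'i set \<Rightarrow> ('i \<Rightarrow> ('r, 'm) module) \<Rightarrow> ('r, 'i \<Rightarrow> 'm) module" where
  "direct_sum I M =
     \<lparr>carrier = {x \<in> (\<Pi>\<^sub>E i\<in>I. carrier (M i)). finite {i \<in> I. x i \<noteq> \<zero>\<^bsub>M i\<^esub>}},
      mult = undefined, one = undefined,
      zero = (\<lambda>i\<in>I. \<zero>\<^bsub>M i\<^esub>),
      add = (\<lambda>x y. \<lambda>i\<in>I. x i \<oplus>\<^bsub>M i\<^esub> y i),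
      smult = (\<lambda>a x. \<lambda>i\<in>I. a \<odot>\<^bsub>M i\<^esub> x i)\<rparr>"

definition projective :: "('r, 'x) ring_scheme \<Rightarrow> 'u set set \<Rightarrow> ('r, 'u) module \<Rightarrow> bool" where
  "projective R U P \<longleftrightarrow> P \<in> right_modules R U \<and>
     (\<forall>M\<in>right_modules R U. \<forall>N\<in>right_modules R U. \<forall>g\<in>Epi R M N. \<forall>f\<in>Hom R P N.
        \<exists>h\<in>Hom R P M. compose (carrier P) g h = f)"

definition right_hereditary :: "('r, 'x) ring_scheme \<Rightarrow> 'u set set \<Rightarrow> bool" where
  "right_hereditary R U \<longleftrightarrow>
     (\<forall>P K. projective R U P \<and> submodule K R P \<longrightarrow> projective R U (P\<lparr>carrier := K\<rparr>))"

definition superfluous :: "('r, 'x) ring_scheme \<Rightarrow> 'm set \<Rightarrow> ('r, 'm) module \<Rightarrow> bool" where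
  "superfluous R K P \<longleftrightarrow> submodule K R P \<and>
     (\<forall>N. submodule N R P \<and> N <+>\<^bsub>P\<^esub> K = carrier P \<longrightarrow> N = carrier P)"

definition projective_cover ::
    "('r, 'x) ring_scheme \<Rightarrow> 'u set set \<Rightarrow> ('r, 'u) module \<Rightarrow> ('r, 'u) module \<Rightarrow> ('u \<Rightarrow> 'u) \<Rightarrow> bool"
  where
  "projective_cover R U M P \<pi> \<longleftrightarrow>
     projective R U P \<and> \<pi> \<in> Epi R P M \<and> superfluous R (a_kernel P M \<pi>) P"

definition right_perfect :: "('r, 'x) ring_scheme \<Rightarrow> 'u set set \<Rightarrow> bool" where
  "right_perfect R U \<longleftrightarrow> (\<forall>M\<in>right_modules R U. \<exists>P \<pi>. projective_cover R U M P \<pi>)"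

definition Gen :: "('r, 'x) ring_scheme \<Rightarrow> 'u set set \<Rightarrow> ('r, 'u) module \<Rightarrow> ('r, 'u) module set"
  where
  "Gen R U T = {X \<in> right_modules R U. \<exists>I\<in>U. Epi R (direct_sum (I :: 'u set) (\<lambda>_. T)) X \<noteq> {}}"

(* Hom(\<sigma>,X) : Hom(P0,X) \<rightarrow> Hom(P1,X) is composition with \<sigma>; P1 plays the role of P_{-1}. *)
definition D_class :: "('r, 'x) ring_scheme \<Rightarrow> 'u set set \<Rightarrow> ('r, 'u) module \<Rightarrow> ('r, 'u) module \<Rightarrow>
    ('u \<Rightarrow> 'u) \<Rightarrow> ('r, 'u) module set" where
  "D_class R U P1 P0 \<sigma> =
     {X \<in> right_modules R U. (\<lambda>g. compose (carrier P1) g \<sigma>) ` Hom R P0 X = Hom R P1 X}"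

definition torsion_class :: "('r, 'x) ring_scheme \<Rightarrow> 'u set set \<Rightarrow> ('r, 'u) module set \<Rightarrow> bool" where
  "torsion_class R U \<T> \<longleftrightarrow> \<T> \<subseteq> right_modules R U \<and>
     (\<forall>M\<in>\<T>. \<forall>N\<in>right_modules R U. Iso R M N \<noteq> {} \<longrightarrow> N \<in> \<T>) \<and>
     (\<forall>M\<in>\<T>. \<forall>N\<in>right_modules R U. Epi R M N \<noteq> {} \<longrightarrow> N \<in> \<T>) \<and>
     (\<forall>I\<in>U. \<forall>M :: 'u \<Rightarrow> ('r, 'u) module. (\<forall>i\<in>I. M i \<in> \<T>) \<longrightarrow>
        (\<forall>N\<in>right_modules R U. Iso R (direct_sum I M) N \<noteq> {} \<longrightarrow> N \<in> \<T>)) \<and>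
     (\<forall>L\<in>\<T>. \<forall>N\<in>\<T>. \<forall>M\<in>right_modules R U. \<forall>f\<in>Hom R L M. \<forall>g\<in>Epi R M N.
        inj_on f (carrier L) \<and> f ` carrier L = a_kernel M N g \<longrightarrow> M \<in> \<T>)"

definition projective_presentation ::
    "('r, 'x) ring_scheme \<Rightarrow> 'u set set \<Rightarrow> ('r, 'u) module \<Rightarrow> ('r, 'u) module \<Rightarrow> ('r, 'u) module \<Rightarrow>
     ('u \<Rightarrow> 'u) \<Rightarrow> ('u \<Rightarrow> 'u) \<Rightarrow> bool" where
  "projective_presentation R U T P1 P0 \<sigma> \<pi> \<longleftrightarrow>
     projective R U P1 \<and> projective R U P0 \<and> \<sigma> \<in> Hom R P1 P0 \<and> \<pi> \<in> Epi R P0 T \<and>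
     \<sigma> ` carrier P1 = a_kernel P0 T \<pi>"

definition silting :: "('r, 'x) ring_scheme \<Rightarrow> 'u set set \<Rightarrow> ('r, 'u) module \<Rightarrow> bool" where
  "silting R U T \<longleftrightarrow> T \<in> right_modules R U \<and>
     (\<exists>P1 P0 \<sigma> \<pi>. projective_presentation R U T P1 P0 \<sigma> \<pi> \<and>
        torsion_class R U (D_class R U P1 P0 \<sigma>) \<and>
        T \<in> D_class R U P1 P0 \<sigma> \<and> D_class R U P1 P0 \<sigma> = Gen R U T)"

(* X may live on a different type than the modules of the class, so that this applies to the
   regular module. *)
definition preenvelope :: "('r, 'x) ring_scheme \<Rightarrow> ('r, 'u) module set \<Rightarrow> ('r, 'm) module \<Rightarrow>
    ('r, 'u) module \<Rightarrow> ('m \<Rightarrow> 'u) \<Rightarrow> bool" where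
  "preenvelope R \<T> X T \<epsilon> \<longleftrightarrow> T \<in> \<T> \<and> \<epsilon> \<in> Hom R X T \<and>
     (\<forall>T'\<in>\<T>. \<forall>f\<in>Hom R X T'. \<exists>g\<in>Hom R T T'. compose (carrier X) g \<epsilon> = f)"

definition envelope :: "('r, 'x) ring_scheme \<Rightarrow> ('r, 'u) module set \<Rightarrow> ('r, 'm) module \<Rightarrow>
    ('r, 'u) module \<Rightarrow> ('m \<Rightarrow> 'u) \<Rightarrow> bool" where
  "envelope R \<T> X T \<epsilon> \<longleftrightarrow> preenvelope R \<T> X T \<epsilon> \<and>
     (\<forall>\<alpha>\<in>Hom R T T. compose (carrier X) \<alpha> \<epsilon> = \<epsilon> \<longrightarrow> \<alpha> \<in> Iso R T T)"

definition enveloping :: "('r, 'x) ring_scheme \<Rightarrow> 'u set set \<Rightarrow> ('r, 'u) module set \<Rightarrow> bool" where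
  "enveloping R U \<T> \<longleftrightarrow> (\<forall>X\<in>right_modules R U. \<exists>T \<epsilon>. envelope R \<T> X T \<epsilon>)"

definition minimal_silting :: "('r, 'x) ring_scheme \<Rightarrow> 'u set set \<Rightarrow> ('r, 'u) module \<Rightarrow> bool" where
  "minimal_silting R U T \<longleftrightarrow> silting R U T \<and>
     (\<exists>M \<epsilon>. envelope R (Gen R U T) (regular_module R) M \<epsilon>)"

end

theory Submission
  imports Defs "HOL-Algebra.Free_Abelian_Groups"
begin

text \<open>
  The substance is that a \<open>\<T>\<close>-envelope \<open>\<epsilon> : R \<rightarrow> M\<close> yields a silting module generating \<open>\<T>\<close>; the
  opposite implication holds by the definition of minimality, and an enveloping class provides an
  envelope of a copy of \<open>R\<close> inside the universe. Put \<open>m = \<epsilon>(1)\<close>. Since homomorphisms from \<open>R\<close> are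
  elements, the envelope property says that every element of every member of \<open>\<T>\<close> is the image of \<open>m\<close>
  under a homomorphism from \<open>M\<close>, and that the endomorphisms of \<open>M\<close> that fix \<open>m\<close> are automorphisms.

  Take a presentation \<open>P1 \<rightarrow> P0 \<rightarrow> M \<rightarrow> 0\<close> with map \<open>\<sigma> : P1 \<rightarrow> P0\<close> such that \<open>P1\<close> is a projective cover of
  the image of \<open>\<sigma>\<close>. It exists over a perfect ring by definition, and over a hereditary ring
  because that image is itself projective (\<open>projective_cover_of_submodule\<close>). Then \<open>\<T>\<close> is contained in
  \<open>D_\<sigma>\<close>. For a map \<open>f : P1 \<rightarrow> X\<close> with \<open>X \<in> \<T>\<close> that vanishes on the kernel of \<open>\<sigma>\<close>, the pushout
  of \<open>f\<close> and \<open>\<sigma>\<close> is an extension of \<open>M\<close> by \<open>X\<close>. Being closed under extensions, \<open>\<T>\<close> contains it, so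
  \<open>M\<close> maps to it with \<open>m\<close> going to a preimage of \<open>m\<close>; thus the extension splits, and \<open>f\<close> extends
  along \<open>\<sigma>\<close> (\<open>Hom_extends_along_presentation\<close>). A general \<open>f\<close> is first made to vanish on the
  kernel by dividing \<open>X\<close> by \<open>f(ker \<sigma>)\<close>, and superfluity of the kernel removes the error
  (\<open>torsion_class_subset_D_class\<close>).

  The class \<open>D_\<sigma>\<close> may be larger than \<open>\<T>\<close>. This is repaired by lifting \<open>\<epsilon>\<close> to \<open>\<eta> : R \<rightarrow> P0\<close> and passing
  to \<open>\<Sigma> : P1 \<oplus> P1 \<oplus> R \<rightarrow> P0 \<oplus> P0\<close>, which is \<open>\<sigma>\<close> on the first summand and \<open>(\<sigma>, \<eta>)\<close> on the other two; its
  cokernel \<open>T\<close> is \<open>M \<oplus> M / mR\<close>. A map on the summand \<open>R\<close> can be corrected by a map from \<open>M\<close> when the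
  target is in \<open>\<T>\<close>, so \<open>\<T>\<close> is contained in \<open>D_\<Sigma>\<close>. Conversely, if \<open>X \<in> D_\<Sigma>\<close> and \<open>x \<in> X\<close>, an
  extension of the map \<open>(0, 0, 1 \<mapsto> x)\<close> restricts on the second copy of \<open>P0\<close> to a map that kills the
  image of \<open>\<sigma>\<close> and hits \<open>x\<close>, that is, to a map \<open>M \<rightarrow> X\<close> hitting \<open>x\<close>. Hence
  \<open>\<T> \<subseteq> D_\<Sigma> \<subseteq> Gen T \<subseteq> \<T>\<close>, the last step because \<open>T\<close> is a quotient of \<open>M \<oplus> M\<close>
  (\<open>silting_if_envelope_at\<close>).
\<close>

section \<open>Homomorphisms of right modules\<close>

lemma right_module_abelian_group: "right_module R M \<Longrightarrow> abelian_group M"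
  by (simp add: right_module_def)

lemma right_modulesD:
  assumes "M \<in> right_modules R U"
  shows "right_module R M" "carrier M \<in> U"
  using assms by (auto simp: right_modules_def)

lemma HomD:
  assumes "f \<in> Hom R M N"
  shows "x \<in> carrier M \<Longrightarrow> f x \<in> carrier N"
    and "\<lbrakk>x \<in> carrier M; y \<in> carrier M\<rbrakk> \<Longrightarrow> f (x \<oplus>\<^bsub>M\<^esub> y) = f x \<oplus>\<^bsub>N\<^esub> f y"
    and "\<lbrakk>a \<in> carrier R; x \<in> carrier M\<rbrakk> \<Longrightarrow> f (a \<odot>\<^bsub>M\<^esub> x) = a \<odot>\<^bsub>N\<^esub> f x"
    and "f \<in> extensional (carrier M)"
  using assms by (auto simp: Hom_def PiE_def)

lemma Hom_eqI:
  assumes "f \<in> Hom R M N" "g \<in> Hom R M L" "\<And>x. x \<in> carrier M \<Longrightarrow> f x = g x"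
  shows "f = g"
  using assms by (meson HomD(4) extensionalityI)

lemma Hom_restrictI:
  assumes "right_module R M"
    and "\<And>x. x \<in> carrier M \<Longrightarrow> f x \<in> carrier N"
    and "\<And>x y. \<lbrakk>x \<in> carrier M; y \<in> carrier M\<rbrakk> \<Longrightarrow> f (x \<oplus>\<^bsub>M\<^esub> y) = f x \<oplus>\<^bsub>N\<^esub> f y"
    and "\<And>a x. \<lbrakk>a \<in> carrier R; x \<in> carrier M\<rbrakk> \<Longrightarrow> f (a \<odot>\<^bsub>M\<^esub> x) = a \<odot>\<^bsub>N\<^esub> f x"
  shows "restrict f (carrier M) \<in> Hom R M N"
proof -
  interpret right_module R M by fact
  show ?thesis
    using assms(2-4) by (auto simp: Hom_def smult_closed)
qed

lemma Hom_zero: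
  assumes "right_module R M" "right_module R N" "f \<in> Hom R M N"
  shows "f \<zero>\<^bsub>M\<^esub> = \<zero>\<^bsub>N\<^esub>"
proof -
  interpret M: abelian_group M using assms by (simp add: right_module_def)
  interpret N: abelian_group N using assms by (simp add: right_module_def)
  have "f \<zero>\<^bsub>M\<^esub> \<oplus>\<^bsub>N\<^esub> f \<zero>\<^bsub>M\<^esub> = f \<zero>\<^bsub>M\<^esub>"
    using HomD(2)[OF assms(3), of "\<zero>\<^bsub>M\<^esub>" "\<zero>\<^bsub>M\<^esub>"] by simp
  then show ?thesis
    using N.add.r_cancel_one HomD(1)[OF assms(3)] by auto
qed

lemma Hom_uminus:
  assumes "right_module R M" "right_module R N" "f \<in> Hom R M N" "x \<in> carrier M"
  shows "f (\<ominus>\<^bsub>M\<^esub> x) = \<ominus>\<^bsub>N\<^esub> f x"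
proof -
  interpret M: abelian_group M using assms by (simp add: right_module_def)
  interpret N: abelian_group N using assms by (simp add: right_module_def)
  have "f (\<ominus>\<^bsub>M\<^esub> x) \<oplus>\<^bsub>N\<^esub> f x = \<zero>\<^bsub>N\<^esub>"
    using HomD(2)[OF assms(3), of "\<ominus>\<^bsub>M\<^esub> x" x] assms(4) Hom_zero[OF assms(1-3)] by (simp add: M.l_neg)
  then show ?thesis
    using assms(4) HomD(1)[OF assms(3)] by (metis M.a_inv_closed N.minus_equality)
qed

lemma Hom_minus:
  assumes "right_module R M" "right_module R N" "f \<in> Hom R M N" "x \<in> carrier M" "y \<in> carrier M"
  shows "f (x \<ominus>\<^bsub>M\<^esub> y) = f x \<ominus>\<^bsub>N\<^esub> f y"
proof -
  interpret M: abelian_group M using assms by (simp add: right_module_def)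
  show ?thesis
    using assms by (simp add: a_minus_def HomD(2)[OF assms(3)] Hom_uminus)
qed

lemma Hom_compose:
  assumes "right_module R M" "f \<in> Hom R M N" "g \<in> Hom R N L"
  shows "compose (carrier M) g f \<in> Hom R M L"
  unfolding compose_def
  by (rule Hom_restrictI) (use assms in \<open>auto simp: HomD\<close>)

lemma Hom_id: "right_module R M \<Longrightarrow> (\<lambda>x\<in>carrier M. x) \<in> Hom R M M"
  by (rule Hom_restrictI) auto

lemma smult_zero:
  assumes "right_module R M" "a \<in> carrier R"
  shows "a \<odot>\<^bsub>M\<^esub> \<zero>\<^bsub>M\<^esub> = \<zero>\<^bsub>M\<^esub>"
proof -
  interpret M: right_module R M by fact
  have "a \<odot>\<^bsub>M\<^esub> \<zero>\<^bsub>M\<^esub> \<oplus>\<^bsub>M\<^esub> a \<odot>\<^bsub>M\<^esub> \<zero>\<^bsub>M\<^esub> = a \<odot>\<^bsub>M\<^esub> \<zero>\<^bsub>M\<^esub>"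
    using M.smult_r_distr[OF assms(2), of "\<zero>\<^bsub>M\<^esub>" "\<zero>\<^bsub>M\<^esub>"] by simp
  then show ?thesis
    using M.M.add.r_cancel_one M.smult_closed[OF assms(2)] by auto
qed

lemma Hom_const_zero:
  assumes "right_module R M" "right_module R N"
  shows "(\<lambda>x\<in>carrier M. \<zero>\<^bsub>N\<^esub>) \<in> Hom R M N"
proof -
  interpret N: abelian_group N using assms by (simp add: right_module_def)
  show ?thesis
    by (rule Hom_restrictI) (use assms in \<open>auto simp: smult_zero\<close>)
qed

lemma Hom_add:
  assumes "right_module R M" "right_module R N" "f \<in> Hom R M N" "g \<in> Hom R M N"
  shows "(\<lambda>x\<in>carrier M. f x \<oplus>\<^bsub>N\<^esub> g x) \<in> Hom R M N"
proof -
  interpret N: right_module R N by fact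
  show ?thesis
    by (rule Hom_restrictI)
      (use assms(1,3,4) in \<open>auto simp: HomD N.smult_r_distr N.M.a_ac\<close>)
qed

lemma Hom_neg:
  assumes "right_module R M" "right_module R N" "f \<in> Hom R M N"
  shows "(\<lambda>x\<in>carrier M. \<ominus>\<^bsub>N\<^esub> f x) \<in> Hom R M N"
proof -
  interpret N: right_module R N by fact
  have smult_neg: "a \<odot>\<^bsub>N\<^esub> (\<ominus>\<^bsub>N\<^esub> y) = \<ominus>\<^bsub>N\<^esub> (a \<odot>\<^bsub>N\<^esub> y)" if "a \<in> carrier R" "y \<in> carrier N" for a y
  proof -
    have "a \<odot>\<^bsub>N\<^esub> (\<ominus>\<^bsub>N\<^esub> y) \<oplus>\<^bsub>N\<^esub> a \<odot>\<^bsub>N\<^esub> y = \<zero>\<^bsub>N\<^esub>"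
      using that N.smult_r_distr[of a "\<ominus>\<^bsub>N\<^esub> y" y] smult_zero[OF assms(2)] by (simp add: N.M.l_neg)
    then show ?thesis
      using that by (metis N.M.a_inv_closed N.M.minus_equality N.smult_closed)
  qed
  show ?thesis
    by (rule Hom_restrictI)
      (use assms in \<open>auto simp: HomD smult_neg N.M.minus_add\<close>)
qed

lemma Hom_diff:
  assumes "right_module R M" "right_module R N" "f \<in> Hom R M N" "g \<in> Hom R M N"
  shows "(\<lambda>x\<in>carrier M. f x \<ominus>\<^bsub>N\<^esub> g x) \<in> Hom R M N"
proof -
  have "(\<lambda>x\<in>carrier M. f x \<oplus>\<^bsub>N\<^esub> (\<lambda>x\<in>carrier M. \<ominus>\<^bsub>N\<^esub> g x) x) \<in> Hom R M N"
    by (intro Hom_add Hom_neg assms)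
  then show ?thesis
    by (simp add: a_minus_def cong: restrict_cong)
qed

lemma EpiD: "f \<in> Epi R M N \<Longrightarrow> f \<in> Hom R M N" "f \<in> Epi R M N \<Longrightarrow> f ` carrier M = carrier N"
  by (auto simp: Epi_def)

lemma Epi_surjE:
  assumes "f \<in> Epi R M N" "y \<in> carrier N"
  obtains x where "x \<in> carrier M" "f x = y"
proof -
  have "y \<in> f ` carrier M"
    using assms by (simp add: Epi_def)
  then show thesis
    using that by (metis imageE)
qed

lemma compose_eqD: "\<lbrakk>compose A g f = h; x \<in> A\<rbrakk> \<Longrightarrow> g (f x) = h x"
  by (drule fun_cong[where x = x]) (simp add: compose_eq)

lemma Iso_imp_Epi: "f \<in> Iso R M N \<Longrightarrow> f \<in> Epi R M N"
  by (auto simp: Iso_def Epi_def bij_betw_def)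

lemma minus_eq_zero_iff:
  assumes "right_module R M" "x \<in> carrier M" "y \<in> carrier M"
  shows "x \<ominus>\<^bsub>M\<^esub> y = \<zero>\<^bsub>M\<^esub> \<longleftrightarrow> x = y"
proof -
  interpret M: abelian_group M using assms by (simp add: right_module_def)
  show ?thesis
    using assms by (metis M.add.inv_closed M.add.inv_comm M.minus_equality M.minus_minus a_minus_def M.r_neg)
qed

lemma Hom_inj_iff:
  assumes "right_module R M" "right_module R N" "f \<in> Hom R M N"
  shows "inj_on f (carrier M) \<longleftrightarrow> (\<forall>x\<in>carrier M. f x = \<zero>\<^bsub>N\<^esub> \<longrightarrow> x = \<zero>\<^bsub>M\<^esub>)"
proof -
  interpret M: abelian_group M using assms by (simp add: right_module_def)
  show ?thesis
  proof
    assume "inj_on f (carrier M)"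
    then show "\<forall>x\<in>carrier M. f x = \<zero>\<^bsub>N\<^esub> \<longrightarrow> x = \<zero>\<^bsub>M\<^esub>"
      using Hom_zero[OF assms] by (metis M.zero_closed inj_onD)
  next
    assume *: "\<forall>x\<in>carrier M. f x = \<zero>\<^bsub>N\<^esub> \<longrightarrow> x = \<zero>\<^bsub>M\<^esub>"
    show "inj_on f (carrier M)"
    proof (rule inj_onI)
      fix x y assume xy: "x \<in> carrier M" "y \<in> carrier M" "f x = f y"
      then have "f (x \<ominus>\<^bsub>M\<^esub> y) = \<zero>\<^bsub>N\<^esub>"
        using assms by (simp add: Hom_minus minus_eq_zero_iff HomD)
      then show "x = y"
        using * xy minus_eq_zero_iff[OF assms(1)] M.minus_closed by metis
    qed
  qed
qed

lemma Hom_factor_Epi: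
  assumes mods: "right_module R A" "right_module R B" "right_module R C"
    and q: "q \<in> Epi R A B" and f: "f \<in> Hom R A C"
    and ker: "\<And>x. \<lbrakk>x \<in> carrier A; q x = \<zero>\<^bsub>B\<^esub>\<rbrakk> \<Longrightarrow> f x = \<zero>\<^bsub>C\<^esub>"
  obtains g where "g \<in> Hom R B C" "\<And>x. x \<in> carrier A \<Longrightarrow> g (q x) = f x"
proof -
  interpret A: right_module R A by fact
  note qH = EpiD(1)[OF q]
  have eq: "f x = f y" if "x \<in> carrier A" "y \<in> carrier A" "q x = q y" for x y
  proof -
    have "q (x \<ominus>\<^bsub>A\<^esub> y) = \<zero>\<^bsub>B\<^esub>"
      using that qH mods by (simp add: Hom_minus minus_eq_zero_iff HomD)
    then have "f (x \<ominus>\<^bsub>A\<^esub> y) = \<zero>\<^bsub>C\<^esub>"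
      using ker that by auto
    then show ?thesis
      using that f mods by (simp add: Hom_minus minus_eq_zero_iff HomD)
  qed
  define r where "r = inv_into (carrier A) q"
  have r: "r b \<in> carrier A" "q (r b) = b" if "b \<in> carrier B" for b
    using that EpiD(2)[OF q] by (auto simp: r_def inv_into_into f_inv_into_f)
  define g where "g = (\<lambda>b\<in>carrier B. f (r b))"
  have gq: "g (q x) = f x" if "x \<in> carrier A" for x
    using that eq[of "r (q x)" x] r[of "q x"] HomD(1)[OF qH] by (auto simp: g_def)
  have surj: "\<exists>x\<in>carrier A. q x = b" if "b \<in> carrier B" for b
    using that r by blast
  have "restrict g (carrier B) \<in> Hom R B C"
  proof (rule Hom_restrictI[OF mods(2)])
    show "g b \<in> carrier C" if "b \<in> carrier B" for b
      using surj[OF that] gq HomD(1)[OF f] by metis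
    show "g (b \<oplus>\<^bsub>B\<^esub> c) = g b \<oplus>\<^bsub>C\<^esub> g c" if bc: "b \<in> carrier B" "c \<in> carrier B" for b c
    proof -
      obtain x y where "x \<in> carrier A" "y \<in> carrier A" "q x = b" "q y = c"
        using surj bc by blast
      then show ?thesis
        using gq[of "x \<oplus>\<^bsub>A\<^esub> y"] gq HomD(2)[OF qH] HomD(2)[OF f] by auto
    qed
    show "g (a \<odot>\<^bsub>B\<^esub> b) = a \<odot>\<^bsub>C\<^esub> g b" if ab: "a \<in> carrier R" "b \<in> carrier B" for a b
    proof -
      obtain x where "x \<in> carrier A" "q x = b"
        using surj ab by blast
      then show ?thesis
        using gq[of "a \<odot>\<^bsub>A\<^esub> x"] gq HomD(3)[OF qH] HomD(3)[OF f] ab A.smult_closed by auto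
    qed
  qed
  moreover have "restrict g (carrier B) = g"
    by (simp add: g_def)
  ultimately show thesis
    using that gq by simp
qed

lemma Hom_factor_Iso:
  assumes mods: "right_module R A" "right_module R B" "right_module R C"
    and \<theta>: "\<theta> \<in> Iso R A B" and f: "f \<in> Hom R A C"
  obtains g where "g \<in> Hom R B C" "\<And>x. x \<in> carrier A \<Longrightarrow> g (\<theta> x) = f x"
proof (rule Hom_factor_Epi[OF mods Iso_imp_Epi[OF \<theta>] f])
  fix x assume x: "x \<in> carrier A" "\<theta> x = \<zero>\<^bsub>B\<^esub>"
  have "inj_on \<theta> (carrier A)"
    using \<theta> by (simp add: Iso_def bij_betw_def)
  then have "x = \<zero>\<^bsub>A\<^esub>"
    using Hom_inj_iff[OF mods(1,2) EpiD(1)[OF Iso_imp_Epi[OF \<theta>]]] x by blast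
  then show "f x = \<zero>\<^bsub>C\<^esub>"
    using Hom_zero[OF mods(1,3) f] by simp
qed (rule that)

lemma Hom_factor_mono:
  assumes mods: "right_module R A" "right_module R B" "right_module R C"
    and j: "j \<in> Hom R A B" "inj_on j (carrier A)" and f: "f \<in> Hom R C B"
    and im: "\<And>x. x \<in> carrier C \<Longrightarrow> f x \<in> j ` carrier A"
  obtains g where "g \<in> Hom R C A" "\<And>x. x \<in> carrier C \<Longrightarrow> j (g x) = f x"
proof -
  interpret A: right_module R A by fact
  interpret C: right_module R C by fact
  define g where "g = (\<lambda>x\<in>carrier C. inv_into (carrier A) j (f x))"
  have g: "g x \<in> carrier A" "j (g x) = f x" if "x \<in> carrier C" for x
    using im[OF that] that by (auto simp: g_def inv_into_into f_inv_into_f)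
  have "restrict g (carrier C) \<in> Hom R C A"
  proof (rule Hom_restrictI[OF mods(3)])
    show "g x \<in> carrier A" if "x \<in> carrier C" for x
      using g that by blast
    show "g (x \<oplus>\<^bsub>C\<^esub> y) = g x \<oplus>\<^bsub>A\<^esub> g y" if "x \<in> carrier C" "y \<in> carrier C" for x y
      using that g by (intro inj_onD[OF j(2)]) (auto simp: HomD[OF j(1)] HomD[OF f])
    show "g (a \<odot>\<^bsub>C\<^esub> x) = a \<odot>\<^bsub>A\<^esub> g x" if "a \<in> carrier R" "x \<in> carrier C" for a x
      using that g
      by (intro inj_onD[OF j(2)]) (auto simp: HomD[OF j(1)] HomD[OF f] A.smult_closed C.smult_closed)
  qed
  moreover have "restrict g (carrier C) = g"
    by (simp add: g_def)
  ultimately show thesis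
    using that g by simp
qed

lemma submoduleI:
  assumes "right_module R M" "K \<subseteq> carrier M" "\<zero>\<^bsub>M\<^esub> \<in> K"
    and "\<And>x y. \<lbrakk>x \<in> K; y \<in> K\<rbrakk> \<Longrightarrow> x \<ominus>\<^bsub>M\<^esub> y \<in> K"
    and "\<And>a x. \<lbrakk>a \<in> carrier R; x \<in> K\<rbrakk> \<Longrightarrow> a \<odot>\<^bsub>M\<^esub> x \<in> K"
  shows "submodule K R M"
proof -
  interpret M: abelian_group M using assms by (simp add: right_module_def)
  have neg: "\<ominus>\<^bsub>M\<^esub> x \<in> K" if "x \<in> K" for x
    using assms(4)[OF assms(3) that] assms(2) that by (auto simp: a_minus_def)
  have add: "x \<oplus>\<^bsub>M\<^esub> y \<in> K" if "x \<in> K" "y \<in> K" for x y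
    using assms(4)[OF that(1) neg[OF that(2)]] assms(2) that by (auto simp: a_minus_def)
  show ?thesis
    by (intro submodule.intro subgroup.intro submodule_axioms.intro)
      (use assms neg add in \<open>auto simp: a_inv_def\<close>)
qed

lemma submoduleD:
  assumes "submodule K R M"
  shows "K \<subseteq> carrier M" "\<zero>\<^bsub>M\<^esub> \<in> K" "x \<in> K \<Longrightarrow> \<ominus>\<^bsub>M\<^esub> x \<in> K"
    "\<lbrakk>x \<in> K; y \<in> K\<rbrakk> \<Longrightarrow> x \<oplus>\<^bsub>M\<^esub> y \<in> K"
    "\<lbrakk>x \<in> K; y \<in> K\<rbrakk> \<Longrightarrow> x \<ominus>\<^bsub>M\<^esub> y \<in> K"
    "\<lbrakk>a \<in> carrier R; x \<in> K\<rbrakk> \<Longrightarrow> a \<odot>\<^bsub>M\<^esub> x \<in> K"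
proof -
  interpret submodule K R M by fact
  show "K \<subseteq> carrier M" "\<zero>\<^bsub>M\<^esub> \<in> K" "x \<in> K \<Longrightarrow> \<ominus>\<^bsub>M\<^esub> x \<in> K"
    "\<lbrakk>x \<in> K; y \<in> K\<rbrakk> \<Longrightarrow> x \<oplus>\<^bsub>M\<^esub> y \<in> K"
    "\<lbrakk>x \<in> K; y \<in> K\<rbrakk> \<Longrightarrow> x \<ominus>\<^bsub>M\<^esub> y \<in> K"
    "\<lbrakk>a \<in> carrier R; x \<in> K\<rbrakk> \<Longrightarrow> a \<odot>\<^bsub>M\<^esub> x \<in> K"
    using subset one_closed m_closed m_inv_closed
    by (auto simp: a_inv_def a_minus_def)
qed

lemma right_module_submodule:
  assumes "right_module R M" "submodule K R M"
  shows "right_module R (M\<lparr>carrier := K\<rparr>)"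
proof -
  interpret M: right_module R M by fact
  note K = submoduleD[OF assms(2)]
  have sub: "x \<in> carrier M" if "x \<in> K" for x
    using K(1) that by blast
  have "abelian_group (M\<lparr>carrier := K\<rparr>)"
  proof (rule abelian_groupI)
    show "\<exists>y\<in>carrier (M\<lparr>carrier := K\<rparr>). y \<oplus>\<^bsub>M\<lparr>carrier := K\<rparr>\<^esub> x = \<zero>\<^bsub>M\<lparr>carrier := K\<rparr>\<^esub>"
      if "x \<in> carrier (M\<lparr>carrier := K\<rparr>)" for x
      using that K(3) sub by (auto intro!: bexI[of _ "\<ominus>\<^bsub>M\<^esub> x"] simp: M.M.l_neg)
  qed (use K sub in \<open>auto simp: M.M.a_ac\<close>)
  then show ?thesis
    using K sub
    by (intro right_module.intro right_module_axioms.intro M.ring_axioms)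
      (auto simp: M.smult_l_distr M.smult_r_distr M.smult_assoc M.smult_one)
qed

lemma submodule_kernel:
  assumes "right_module R M" "right_module R N" "f \<in> Hom R M N"
  shows "submodule (a_kernel M N f) R M"
proof -
  interpret M: right_module R M by fact
  interpret N: right_module R N by fact
  show ?thesis
    unfolding a_kernel_def'
    by (rule submoduleI)
      (use assms in \<open>auto simp: Hom_zero Hom_minus minus_eq_zero_iff HomD M.smult_closed smult_zero\<close>)
qed

lemma submodule_image:
  assumes "right_module R M" "right_module R N" "f \<in> Hom R M N" "submodule K R M"
  shows "submodule (f ` K) R N"
proof -
  note K = submoduleD[OF assms(4)]
  have sub: "x \<in> carrier M" if "x \<in> K" for x
    using K(1) that by blast
  show ?thesis
  proof (rule submoduleI[OF assms(2)])
    show "f ` K \<subseteq> carrier N"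
      using sub HomD(1)[OF assms(3)] by blast
    show "\<zero>\<^bsub>N\<^esub> \<in> f ` K"
      using Hom_zero[OF assms(1-3)] K(2) by (metis imageI)
    show "u \<ominus>\<^bsub>N\<^esub> v \<in> f ` K" if "u \<in> f ` K" "v \<in> f ` K" for u v
      using that Hom_minus[OF assms(1-3)] K(5) sub by (auto simp: image_iff) metis
    show "a \<odot>\<^bsub>N\<^esub> u \<in> f ` K" if "a \<in> carrier R" "u \<in> f ` K" for a u
      using that HomD(3)[OF assms(3)] K(6) sub by (auto simp: image_iff) metis
  qed
qed

lemma submodule_carrier:
  assumes "right_module R M"
  shows "submodule (carrier M) R M"
proof -
  interpret M: right_module R M by fact
  show ?thesis
    by (rule submoduleI) (use assms in \<open>auto simp: M.smult_closed\<close>)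
qed

section \<open>Quotients and copies of modules inside the universe\<close>

text \<open>The structure that a map out of the carrier of \<open>M\<close> induces on its image, provided that the
  map identifies elements compatibly with the operations. Injective maps give copies of \<open>M\<close>,
  choices of coset representatives give quotients.\<close>

definition image_module :: "('m \<Rightarrow> 'n) \<Rightarrow> ('r, 'm) module \<Rightarrow> ('r, 'n) module" where
  "image_module \<phi> M =
     \<lparr>carrier = \<phi> ` carrier M, mult = undefined, one = undefined,
      ring.zero = \<phi> \<zero>\<^bsub>M\<^esub>,
      add = (\<lambda>u v. \<phi> (inv_into (carrier M) \<phi> u \<oplus>\<^bsub>M\<^esub> inv_into (carrier M) \<phi> v)),
      smult = (\<lambda>a u. \<phi> (a \<odot>\<^bsub>M\<^esub> inv_into (carrier M) \<phi> u))\<rparr>"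

lemma image_module:
  assumes M: "right_module R M"
    and cong_add: "\<And>x x' y y'. \<lbrakk>x \<in> carrier M; x' \<in> carrier M; y \<in> carrier M; y' \<in> carrier M;
        \<phi> x = \<phi> x'; \<phi> y = \<phi> y'\<rbrakk> \<Longrightarrow> \<phi> (x \<oplus>\<^bsub>M\<^esub> y) = \<phi> (x' \<oplus>\<^bsub>M\<^esub> y')"
    and cong_smult: "\<And>a x x'. \<lbrakk>a \<in> carrier R; x \<in> carrier M; x' \<in> carrier M; \<phi> x = \<phi> x'\<rbrakk>
        \<Longrightarrow> \<phi> (a \<odot>\<^bsub>M\<^esub> x) = \<phi> (a \<odot>\<^bsub>M\<^esub> x')"
  shows "right_module R (image_module \<phi> M)"
    and "restrict \<phi> (carrier M) \<in> Epi R M (image_module \<phi> M)"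
proof -
  interpret M: right_module R M by fact
  let ?N = "image_module \<phi> M"
  have inv: "inv_into (carrier M) \<phi> (\<phi> x) \<in> carrier M"
    "\<phi> (inv_into (carrier M) \<phi> (\<phi> x)) = \<phi> x" if "x \<in> carrier M" for x
    using that by (auto intro: inv_into_into f_inv_into_f)
  have add: "\<phi> x \<oplus>\<^bsub>?N\<^esub> \<phi> y = \<phi> (x \<oplus>\<^bsub>M\<^esub> y)" if "x \<in> carrier M" "y \<in> carrier M" for x y
    using that inv by (auto simp: image_module_def intro!: cong_add)
  have smult: "a \<odot>\<^bsub>?N\<^esub> \<phi> x = \<phi> (a \<odot>\<^bsub>M\<^esub> x)" if "a \<in> carrier R" "x \<in> carrier M" for a x
    using that inv by (auto simp: image_module_def intro!: cong_smult)
  have carrier: "carrier ?N = \<phi> ` carrier M" and zero: "\<zero>\<^bsub>?N\<^esub> = \<phi> \<zero>\<^bsub>M\<^esub>"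
    by (simp_all add: image_module_def)
  have "abelian_group ?N"
  proof (rule abelian_groupI)
    show "\<exists>v\<in>carrier ?N. v \<oplus>\<^bsub>?N\<^esub> u = \<zero>\<^bsub>?N\<^esub>" if u: "u \<in> carrier ?N" for u
    proof -
      obtain x where "x \<in> carrier M" "u = \<phi> x"
        using u by (auto simp: carrier)
      then show ?thesis
        by (intro bexI[of _ "\<phi> (\<ominus>\<^bsub>M\<^esub> x)"]) (auto simp: add zero carrier M.M.l_neg)
    qed
  qed (auto simp: carrier zero add M.M.a_ac)
  then show "right_module R ?N"
    by (intro right_module.intro right_module_axioms.intro M.ring_axioms)
      (auto simp: carrier add smult M.smult_closed M.smult_l_distr M.smult_r_distr M.smult_assoc
        M.smult_one)
  have "restrict \<phi> (carrier M) \<in> Hom R M ?N"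
    by (rule Hom_restrictI[OF M]) (auto simp: carrier add smult)
  then show "restrict \<phi> (carrier M) \<in> Epi R M ?N"
    by (auto simp: Epi_def carrier)
qed

context universe
begin

lemma transport_module:
  fixes \<phi> :: "'m \<Rightarrow> 'u"
  assumes "right_module R M" "inj_on \<phi> (carrier M)" "\<phi> ` carrier M \<in> U"
  obtains N \<theta> where "N \<in> right_modules R U" "\<theta> \<in> Iso R M N"
proof -
  interpret M: right_module R M by fact
  have cong: "\<phi> (x \<oplus>\<^bsub>M\<^esub> y) = \<phi> (x' \<oplus>\<^bsub>M\<^esub> y')"
    if "x \<in> carrier M" "x' \<in> carrier M" "y \<in> carrier M" "y' \<in> carrier M" "\<phi> x = \<phi> x'" "\<phi> y = \<phi> y'"
    for x x' y y'
    using that inj_onD[OF assms(2)] by metis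
  have cong': "\<phi> (a \<odot>\<^bsub>M\<^esub> x) = \<phi> (a \<odot>\<^bsub>M\<^esub> x')"
    if "x \<in> carrier M" "x' \<in> carrier M" "\<phi> x = \<phi> x'" for a x x'
    using that inj_onD[OF assms(2)] by metis
  have "right_module R (image_module \<phi> M)" "restrict \<phi> (carrier M) \<in> Epi R M (image_module \<phi> M)"
    using image_module[OF assms(1), of \<phi>] cong cong' by blast+
  then show thesis
    using assms that[of "image_module \<phi> M" "restrict \<phi> (carrier M)"]
    by (auto simp: right_modules_def image_module_def Iso_def Epi_def bij_betw_def)
qed

text \<open>Choosing one element of each coset keeps the quotient inside the carrier of the module, hence
  inside the universe.\<close>

lemma quotient_module:
  assumes M: "M \<in> right_modules R U" and sub: "submodule K R M"
  obtains N q where "N \<in> right_modules R U" "q \<in> Epi R M N"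
    "\<And>x. x \<in> carrier M \<Longrightarrow> q x = \<zero>\<^bsub>N\<^esub> \<longleftrightarrow> x \<in> K"
proof -
  note modM = right_modulesD(1)[OF M]
  interpret M: right_module R M by fact
  note K = submoduleD[OF sub]
  define \<phi> where "\<phi> x = (SOME y. y \<in> carrier M \<and> x \<ominus>\<^bsub>M\<^esub> y \<in> K)" for x
  have \<phi>: "\<phi> x \<in> carrier M" "x \<ominus>\<^bsub>M\<^esub> \<phi> x \<in> K" if "x \<in> carrier M" for x
  proof -
    have "x \<in> carrier M \<and> x \<ominus>\<^bsub>M\<^esub> x \<in> K"
      using that K(2) minus_eq_zero_iff[OF modM that that] by simp
    then have "\<phi> x \<in> carrier M \<and> x \<ominus>\<^bsub>M\<^esub> \<phi> x \<in> K"
      unfolding \<phi>_def by (rule someI)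
    then show "\<phi> x \<in> carrier M" "x \<ominus>\<^bsub>M\<^esub> \<phi> x \<in> K" by auto
  qed
  have telescope: "(x \<ominus>\<^bsub>M\<^esub> y) \<oplus>\<^bsub>M\<^esub> (y \<ominus>\<^bsub>M\<^esub> z) = x \<ominus>\<^bsub>M\<^esub> z"
    if "x \<in> carrier M" "y \<in> carrier M" "z \<in> carrier M" for x y z
    using that by (simp add: a_minus_def M.M.a_ac M.M.r_neg1 M.M.r_neg2)
  have sym: "y \<ominus>\<^bsub>M\<^esub> x \<in> K" if "x \<in> carrier M" "y \<in> carrier M" "x \<ominus>\<^bsub>M\<^esub> y \<in> K" for x y
    using K(3)[OF that(3)] that by (simp add: a_minus_def M.M.minus_add M.M.a_ac)
  have trans: "x \<ominus>\<^bsub>M\<^esub> z \<in> K"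
    if "x \<in> carrier M" "y \<in> carrier M" "z \<in> carrier M" "x \<ominus>\<^bsub>M\<^esub> y \<in> K" "y \<ominus>\<^bsub>M\<^esub> z \<in> K" for x y z
    using K(4)[OF that(4,5)] telescope that by simp
  have \<phi>_eq: "\<phi> x = \<phi> y \<longleftrightarrow> x \<ominus>\<^bsub>M\<^esub> y \<in> K" if xy: "x \<in> carrier M" "y \<in> carrier M" for x y
  proof
    assume "\<phi> x = \<phi> y"
    then show "x \<ominus>\<^bsub>M\<^esub> y \<in> K"
      using \<phi>[OF xy(1)] \<phi>[OF xy(2)] sym trans xy by metis
  next
    assume "x \<ominus>\<^bsub>M\<^esub> y \<in> K"
    then have "x \<ominus>\<^bsub>M\<^esub> z \<in> K \<longleftrightarrow> y \<ominus>\<^bsub>M\<^esub> z \<in> K" if "z \<in> carrier M" for z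
      using trans sym xy that by metis
    then show "\<phi> x = \<phi> y"
      unfolding \<phi>_def by metis
  qed
  have diff_add: "(x \<oplus>\<^bsub>M\<^esub> y) \<ominus>\<^bsub>M\<^esub> (x' \<oplus>\<^bsub>M\<^esub> y') = (x \<ominus>\<^bsub>M\<^esub> x') \<oplus>\<^bsub>M\<^esub> (y \<ominus>\<^bsub>M\<^esub> y')"
    if "x \<in> carrier M" "x' \<in> carrier M" "y \<in> carrier M" "y' \<in> carrier M" for x x' y y'
    using that by (simp add: a_minus_def M.M.minus_add M.M.a_ac)
  have diff_smult: "a \<odot>\<^bsub>M\<^esub> x \<ominus>\<^bsub>M\<^esub> a \<odot>\<^bsub>M\<^esub> y = a \<odot>\<^bsub>M\<^esub> (x \<ominus>\<^bsub>M\<^esub> y)"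
    if "a \<in> carrier R" "x \<in> carrier M" "y \<in> carrier M" for a x y
  proof -
    have "a \<odot>\<^bsub>M\<^esub> (x \<ominus>\<^bsub>M\<^esub> y) \<oplus>\<^bsub>M\<^esub> a \<odot>\<^bsub>M\<^esub> y = a \<odot>\<^bsub>M\<^esub> ((x \<ominus>\<^bsub>M\<^esub> y) \<oplus>\<^bsub>M\<^esub> y)"
      using that M.smult_r_distr by simp
    also have "(x \<ominus>\<^bsub>M\<^esub> y) \<oplus>\<^bsub>M\<^esub> y = x"
      using that by (simp add: a_minus_def M.M.a_assoc M.M.l_neg)
    finally show ?thesis
      using that M.smult_closed M.M.minus_closed
      by (metis M.M.a_comm M.M.a_inv_closed M.M.add.inv_solve_right a_minus_def)
  qed
  have cong: "\<phi> (x \<oplus>\<^bsub>M\<^esub> y) = \<phi> (x' \<oplus>\<^bsub>M\<^esub> y')"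
    if "x \<in> carrier M" "x' \<in> carrier M" "y \<in> carrier M" "y' \<in> carrier M" "\<phi> x = \<phi> x'" "\<phi> y = \<phi> y'"
    for x x' y y'
    using that K(4) by (simp add: \<phi>_eq diff_add)
  have cong': "\<phi> (a \<odot>\<^bsub>M\<^esub> x) = \<phi> (a \<odot>\<^bsub>M\<^esub> x')"
    if "a \<in> carrier R" "x \<in> carrier M" "x' \<in> carrier M" "\<phi> x = \<phi> x'" for a x x'
    using that K(6) by (simp add: \<phi>_eq diff_smult M.smult_closed)
  let ?N = "image_module \<phi> M"
  have N: "right_module R ?N" "restrict \<phi> (carrier M) \<in> Epi R M ?N"
    using image_module[OF modM, of \<phi>] cong cong' by blast+
  have "carrier ?N \<subseteq> carrier M"
    using \<phi>(1) by (auto simp: image_module_def)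
  then have N_in: "?N \<in> right_modules R U"
    using N(1) subset_closed right_modulesD(2)[OF M] by (auto simp: right_modules_def)
  have minus_0: "\<ominus>\<^bsub>M\<^esub> \<zero>\<^bsub>M\<^esub> = \<zero>\<^bsub>M\<^esub>"
    by (metis M.M.l_zero M.M.minus_equality M.M.zero_closed)
  have "restrict \<phi> (carrier M) x = \<zero>\<^bsub>?N\<^esub> \<longleftrightarrow> x \<in> K" if "x \<in> carrier M" for x
    using that \<phi>_eq[of x "\<zero>\<^bsub>M\<^esub>"] minus_0 by (simp add: image_module_def a_minus_def)
  then show thesis
    using that N(2) N_in by blast
qed

end

section \<open>Direct sums and free modules\<close>

definition single :: "'i set \<Rightarrow> ('i \<Rightarrow> ('r, 'm) module) \<Rightarrow> 'i \<Rightarrow> 'm \<Rightarrow> 'i \<Rightarrow> 'm" where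
  "single I M i x = (\<lambda>j\<in>I. if j = i then x else \<zero>\<^bsub>M j\<^esub>)"

lemma direct_sum_carrier:
  "x \<in> carrier (direct_sum I M) \<longleftrightarrow>
    x \<in> extensional I \<and> (\<forall>i\<in>I. x i \<in> carrier (M i)) \<and> finite {i \<in> I. x i \<noteq> \<zero>\<^bsub>M i\<^esub>}"
  by (auto simp: direct_sum_def PiE_def)

lemma direct_sum_simps:
  "\<zero>\<^bsub>direct_sum I M\<^esub> = (\<lambda>i\<in>I. \<zero>\<^bsub>M i\<^esub>)"
  "x \<oplus>\<^bsub>direct_sum I M\<^esub> y = (\<lambda>i\<in>I. x i \<oplus>\<^bsub>M i\<^esub> y i)"
  "a \<odot>\<^bsub>direct_sum I M\<^esub> x = (\<lambda>i\<in>I. a \<odot>\<^bsub>M i\<^esub> x i)"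
  by (simp_all add: direct_sum_def)

locale module_family =
  fixes R :: "('r, 'x) ring_scheme" and I :: "'i set" and M :: "'i \<Rightarrow> ('r, 'm) module"
  assumes ring_R: "ring R" and mods: "i \<in> I \<Longrightarrow> right_module R (M i)"
begin

lemma abelian: "i \<in> I \<Longrightarrow> abelian_group (M i)"
  using mods by (rule right_module_abelian_group)

lemma zero_closed: "i \<in> I \<Longrightarrow> \<zero>\<^bsub>M i\<^esub> \<in> carrier (M i)"
  using abelian by (simp add: abelian_groupE)

lemma direct_sum_add_closed:
  assumes "x \<in> carrier (direct_sum I M)" "y \<in> carrier (direct_sum I M)"
  shows "x \<oplus>\<^bsub>direct_sum I M\<^esub> y \<in> carrier (direct_sum I M)"
proof -
  have "{i \<in> I. x i \<oplus>\<^bsub>M i\<^esub> y i \<noteq> \<zero>\<^bsub>M i\<^esub>} \<subseteq> {i \<in> I. x i \<noteq> \<zero>\<^bsub>M i\<^esub>} \<union> {i \<in> I. y i \<noteq> \<zero>\<^bsub>M i\<^esub>}"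
    using zero_closed abelian_groupE(5)[OF abelian] by auto
  then have "finite {i \<in> I. x i \<oplus>\<^bsub>M i\<^esub> y i \<noteq> \<zero>\<^bsub>M i\<^esub>}"
    using assms by (auto simp: direct_sum_carrier intro: finite_subset)
  then show ?thesis
    using assms abelian
    by (auto simp: direct_sum_carrier direct_sum_simps abelian_groupE cong: conj_cong)
qed

lemma direct_sum_smult_closed:
  assumes "x \<in> carrier (direct_sum I M)" "a \<in> carrier R"
  shows "a \<odot>\<^bsub>direct_sum I M\<^esub> x \<in> carrier (direct_sum I M)"
proof -
  have "{i \<in> I. a \<odot>\<^bsub>M i\<^esub> x i \<noteq> \<zero>\<^bsub>M i\<^esub>} \<subseteq> {i \<in> I. x i \<noteq> \<zero>\<^bsub>M i\<^esub>}"
    using smult_zero[OF mods assms(2)] by auto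
  then have "finite {i \<in> I. a \<odot>\<^bsub>M i\<^esub> x i \<noteq> \<zero>\<^bsub>M i\<^esub>}"
    using assms by (auto simp: direct_sum_carrier intro: finite_subset)
  then show ?thesis
    using assms mods
    by (auto simp: direct_sum_carrier direct_sum_simps right_module.smult_closed[OF mods] cong: conj_cong)
qed

lemma direct_sum_right_module: "right_module R (direct_sum I M)"
proof -
  let ?S = "direct_sum I M"
  have eqI: "x = y" if "x \<in> extensional I" "y \<in> extensional I" "\<And>i. i \<in> I \<Longrightarrow> x i = y i"
    for x y :: "'i \<Rightarrow> 'm"
    using that by (rule extensionalityI)
  have mem: "x i \<in> carrier (M i)" if "x \<in> carrier ?S" "i \<in> I" for x i
    using that by (simp add: direct_sum_carrier)
  have "abelian_group ?S"
  proof (rule abelian_groupI)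
    show "\<zero>\<^bsub>?S\<^esub> \<in> carrier ?S"
      using zero_closed by (auto simp: direct_sum_carrier direct_sum_simps cong: conj_cong)
    show "(x \<oplus>\<^bsub>?S\<^esub> y) \<oplus>\<^bsub>?S\<^esub> z = x \<oplus>\<^bsub>?S\<^esub> (y \<oplus>\<^bsub>?S\<^esub> z)"
      if "x \<in> carrier ?S" "y \<in> carrier ?S" "z \<in> carrier ?S" for x y z
      by (rule eqI) (use that mem in \<open>auto simp: direct_sum_simps abelian_groupE(1,3)[OF abelian]\<close>)
    show "x \<oplus>\<^bsub>?S\<^esub> y = y \<oplus>\<^bsub>?S\<^esub> x" if "x \<in> carrier ?S" "y \<in> carrier ?S" for x y
      by (rule eqI) (use that mem abelian in \<open>auto simp: direct_sum_simps intro: abelian_groupE\<close>)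
    show "\<zero>\<^bsub>?S\<^esub> \<oplus>\<^bsub>?S\<^esub> x = x" if "x \<in> carrier ?S" for x
      by (rule eqI) (use that mem in \<open>auto simp: direct_sum_simps abelian_groupE(5)[OF abelian] direct_sum_carrier\<close>)
    show "\<exists>y\<in>carrier ?S. y \<oplus>\<^bsub>?S\<^esub> x = \<zero>\<^bsub>?S\<^esub>" if x: "x \<in> carrier ?S" for x
    proof
      let ?y = "\<lambda>i\<in>I. \<ominus>\<^bsub>M i\<^esub> x i"
      have "finite {i \<in> I. \<ominus>\<^bsub>M i\<^esub> x i \<noteq> \<zero>\<^bsub>M i\<^esub>}"
        by (rule finite_subset[of _ "{i \<in> I. x i \<noteq> \<zero>\<^bsub>M i\<^esub>}"])
          (use x abelian in \<open>auto simp: direct_sum_carrier abelian_group.minus_equality abelian_groupE\<close>)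
      then show "?y \<in> carrier ?S"
        using x abelian by (auto simp: direct_sum_carrier abelian_group.a_inv_closed cong: conj_cong)
      show "?y \<oplus>\<^bsub>?S\<^esub> x = \<zero>\<^bsub>?S\<^esub>"
        by (rule eqI) (use mem[OF x] abelian in \<open>auto simp: direct_sum_simps abelian_group.l_neg\<close>)
    qed
  qed (rule direct_sum_add_closed)
  then show ?thesis
  proof (intro right_module.intro right_module_axioms.intro ring_R)
    show "a \<odot>\<^bsub>?S\<^esub> x \<in> carrier ?S" if "a \<in> carrier R" "x \<in> carrier ?S" for a x
      using that by (simp add: direct_sum_smult_closed)
    show "(a \<oplus>\<^bsub>R\<^esub> b) \<odot>\<^bsub>?S\<^esub> x = a \<odot>\<^bsub>?S\<^esub> x \<oplus>\<^bsub>?S\<^esub> b \<odot>\<^bsub>?S\<^esub> x"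
      if "a \<in> carrier R" "b \<in> carrier R" "x \<in> carrier ?S" for a b x
      by (rule eqI) (use that mem mods in \<open>auto simp: direct_sum_simps right_module.smult_l_distr[OF mods]\<close>)
    show "a \<odot>\<^bsub>?S\<^esub> (x \<oplus>\<^bsub>?S\<^esub> y) = a \<odot>\<^bsub>?S\<^esub> x \<oplus>\<^bsub>?S\<^esub> a \<odot>\<^bsub>?S\<^esub> y"
      if "a \<in> carrier R" "x \<in> carrier ?S" "y \<in> carrier ?S" for a x y
      by (rule eqI) (use that mem mods in \<open>auto simp: direct_sum_simps right_module.smult_r_distr[OF mods]\<close>)
    show "(a \<otimes>\<^bsub>R\<^esub> b) \<odot>\<^bsub>?S\<^esub> x = b \<odot>\<^bsub>?S\<^esub> (a \<odot>\<^bsub>?S\<^esub> x)"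
      if "a \<in> carrier R" "b \<in> carrier R" "x \<in> carrier ?S" for a b x
      by (rule eqI) (use that mem mods in \<open>auto simp: direct_sum_simps right_module.smult_assoc[OF mods]\<close>)
    show "\<one>\<^bsub>R\<^esub> \<odot>\<^bsub>?S\<^esub> x = x" if "x \<in> carrier ?S" for x
      by (rule eqI)
        (use that mem mods in \<open>auto simp: direct_sum_simps right_module.smult_one[OF mods] direct_sum_carrier\<close>)
  qed
qed

lemma single_carrier: "\<lbrakk>i \<in> I; x \<in> carrier (M i)\<rbrakk> \<Longrightarrow> single I M i x \<in> carrier (direct_sum I M)"
  using zero_closed
  by (auto simp: direct_sum_carrier single_def intro: finite_subset[of _ "{i}"])

lemma Hom_single:
  assumes "i \<in> I"
  shows "(\<lambda>x\<in>carrier (M i). single I M i x) \<in> Hom R (M i) (direct_sum I M)"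
proof (rule Hom_restrictI[OF mods[OF assms]])
  show "single I M i x \<in> carrier (direct_sum I M)" if "x \<in> carrier (M i)" for x
    using that assms single_carrier by simp
  show "single I M i (x \<oplus>\<^bsub>M i\<^esub> y) = single I M i x \<oplus>\<^bsub>direct_sum I M\<^esub> single I M i y"
    if "x \<in> carrier (M i)" "y \<in> carrier (M i)" for x y
    using abelian zero_closed by (auto simp: single_def direct_sum_simps abelian_groupE)
  show "single I M i (a \<odot>\<^bsub>M i\<^esub> x) = a \<odot>\<^bsub>direct_sum I M\<^esub> single I M i x"
    if "a \<in> carrier R" "x \<in> carrier (M i)" for a x
    using that smult_zero[OF mods] by (auto simp: single_def direct_sum_simps)
qed

text \<open>Induction on a finite set containing the support: splitting off one coordinate writes an
  element as a sum of one with smaller support and one concentrated in a single place.\<close>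

lemma direct_sum_hom_eqI:
  assumes N: "right_module R N" and f: "f \<in> Hom R (direct_sum I M) N"
    and g: "g \<in> Hom R (direct_sum I M) N"
    and eq: "\<And>i x. \<lbrakk>i \<in> I; x \<in> carrier (M i)\<rbrakk> \<Longrightarrow> f (single I M i x) = g (single I M i x)"
  shows "f = g"
proof -
  have "f x = g x" if "finite J" "x \<in> carrier (direct_sum I M)" "{i \<in> I. x i \<noteq> \<zero>\<^bsub>M i\<^esub>} \<subseteq> J" for J x
    using that
  proof (induction J arbitrary: x rule: finite_induct)
    case empty
    then have "x = \<zero>\<^bsub>direct_sum I M\<^esub>"
      by (auto simp: direct_sum_simps direct_sum_carrier extensional_def fun_eq_iff)
    then show ?case
      using f g N direct_sum_right_module by (simp add: Hom_zero)
  next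
    case (insert j J)
    show ?case
    proof (cases "j \<in> I")
      case False
      then show ?thesis
        using insert by auto
    next
      case True
      define y where "y = (\<lambda>i\<in>I. if i = j then \<zero>\<^bsub>M j\<^esub> else x i)"
      have y: "y \<in> carrier (direct_sum I M)" "{i \<in> I. y i \<noteq> \<zero>\<^bsub>M i\<^esub>} \<subseteq> J"
        using insert.prems insert.hyps(1) zero_closed True
        by (auto simp: y_def direct_sum_carrier intro: finite_subset[of _ J])
      have xj: "x j \<in> carrier (M j)"
        using insert.prems True by (simp add: direct_sum_carrier)
      have "x = y \<oplus>\<^bsub>direct_sum I M\<^esub> single I M j (x j)"
      proof (rule extensionalityI)
        show "x \<in> extensional I"
          using insert.prems by (simp add: direct_sum_carrier)
        show "x i = (y \<oplus>\<^bsub>direct_sum I M\<^esub> single I M j (x j)) i" if "i \<in> I" for i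
        proof -
          interpret Mi: abelian_group "M i" using that by (rule abelian)
          have "x i \<in> carrier (M i)"
            using insert.prems that by (simp add: direct_sum_carrier)
          then show ?thesis
            using that True abelian_groupE(5)[OF abelian]
            by (auto simp: y_def single_def direct_sum_simps)
        qed
      qed (simp add: direct_sum_simps)
      then show ?thesis
        using HomD(2)[OF f y(1) single_carrier[OF True xj]]
          HomD(2)[OF g y(1) single_carrier[OF True xj]] insert.IH[OF y] eq[OF True xj] by simp
    qed
  qed
  then show ?thesis
    using f g by (intro Hom_eqI[OF f g]) (auto simp: direct_sum_carrier)
qed

lemma direct_sum_copair:
  assumes N: "right_module R N" and f: "\<And>i. i \<in> I \<Longrightarrow> f i \<in> Hom R (M i) N"
  obtains h where "h \<in> Hom R (direct_sum I M) N"
    "\<And>i x. \<lbrakk>i \<in> I; x \<in> carrier (M i)\<rbrakk> \<Longrightarrow> h (single I M i x) = f i x"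
proof -
  interpret N: right_module R N by fact
  let ?S = "direct_sum I M"
  define supp where "supp x = {i \<in> I. x i \<noteq> \<zero>\<^bsub>M i\<^esub>}" for x
  define h where "h x = finsum N (\<lambda>i. f i (x i)) (supp x)" for x
  have fin: "finite (supp x)" if "x \<in> carrier ?S" for x
    using that by (simp add: supp_def direct_sum_carrier)
  have mem: "f i (x i) \<in> carrier N" if "x \<in> carrier ?S" "i \<in> I" for x i
    using that HomD(1)[OF f] by (simp add: direct_sum_carrier)
  \<comment> \<open>Sums over different supports become comparable over a common finite index set.\<close>
  have h_eq: "h x = finsum N (\<lambda>i. f i (x i)) J"
    if "x \<in> carrier ?S" "finite J" "supp x \<subseteq> J" "J \<subseteq> I" for x J
    unfolding h_def
    using that mem Hom_zero[OF mods N f]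
    by (intro N.M.add.finprod_mono_neutral_cong_left) (auto simp: supp_def)
  have "restrict h (carrier ?S) \<in> Hom R ?S N"
  proof (rule Hom_restrictI[OF direct_sum_right_module])
    show "h x \<in> carrier N" if "x \<in> carrier ?S" for x
      unfolding h_def by (rule N.M.finsum_closed) (use that mem in \<open>auto simp: supp_def\<close>)
    show "h (x \<oplus>\<^bsub>?S\<^esub> y) = h x \<oplus>\<^bsub>N\<^esub> h y" if xy: "x \<in> carrier ?S" "y \<in> carrier ?S" for x y
    proof -
      let ?J = "supp x \<union> supp y"
      have J: "finite ?J" "?J \<subseteq> I"
        using fin xy by (auto simp: supp_def)
      have "supp (x \<oplus>\<^bsub>?S\<^esub> y) \<subseteq> ?J"
        using zero_closed abelian_groupE(5)[OF abelian] by (auto simp: supp_def direct_sum_simps)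
      then have "h (x \<oplus>\<^bsub>?S\<^esub> y) = finsum N (\<lambda>i. f i ((x \<oplus>\<^bsub>?S\<^esub> y) i)) ?J"
        using xy J by (intro h_eq direct_sum_add_closed)
      also have "\<dots> = finsum N (\<lambda>i. f i (x i) \<oplus>\<^bsub>N\<^esub> f i (y i)) ?J"
        using J xy mem
        by (intro N.M.finsum_cong') (auto simp: direct_sum_simps HomD(2)[OF f] direct_sum_carrier)
      also have "\<dots> = finsum N (\<lambda>i. f i (x i)) ?J \<oplus>\<^bsub>N\<^esub> finsum N (\<lambda>i. f i (y i)) ?J"
        using J xy mem by (intro N.M.finsum_addf) auto
      also have "\<dots> = h x \<oplus>\<^bsub>N\<^esub> h y"
        using h_eq[OF xy(1) J(1) _ J(2)] h_eq[OF xy(2) J(1) _ J(2)] by simp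
      finally show ?thesis .
    qed
    show "h (a \<odot>\<^bsub>?S\<^esub> x) = a \<odot>\<^bsub>N\<^esub> h x" if ax: "a \<in> carrier R" "x \<in> carrier ?S" for a x
    proof -
      have J: "finite (supp x)" "supp x \<subseteq> I"
        using fin ax by (auto simp: supp_def)
      have dist: "a \<odot>\<^bsub>N\<^esub> finsum N u J = finsum N (\<lambda>i. a \<odot>\<^bsub>N\<^esub> u i) J"
        if "finite J" "u \<in> J \<rightarrow> carrier N" for u J
        using that
      proof (induction J rule: finite_induct)
        case empty
        then show ?case by (simp add: smult_zero[OF N ax(1)])
      next
        case (insert j J)
        then show ?case
          using ax(1) N.smult_closed N.smult_r_distr[OF ax(1)]
          by (subst (1 2) N.M.finsum_insert) (auto simp: N.M.finsum_closed Pi_iff)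
      qed
      have "supp (a \<odot>\<^bsub>?S\<^esub> x) \<subseteq> supp x"
        using smult_zero[OF mods ax(1)] by (auto simp: supp_def direct_sum_simps)
      then have "h (a \<odot>\<^bsub>?S\<^esub> x) = finsum N (\<lambda>i. f i ((a \<odot>\<^bsub>?S\<^esub> x) i)) (supp x)"
        using ax J by (intro h_eq direct_sum_smult_closed)
      also have "\<dots> = finsum N (\<lambda>i. a \<odot>\<^bsub>N\<^esub> f i (x i)) (supp x)"
        using J ax mem N.smult_closed
        by (intro N.M.finsum_cong') (auto simp: direct_sum_simps HomD(3)[OF f] direct_sum_carrier)
      also have "\<dots> = a \<odot>\<^bsub>N\<^esub> h x"
        unfolding h_def using J ax mem by (intro dist[symmetric]) auto
      finally show ?thesis .
    qed
  qed
  moreover have "restrict h (carrier ?S) (single I M i x) = f i x" if "i \<in> I" "x \<in> carrier (M i)" for i x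
  proof -
    have "h (single I M i x) = finsum N (\<lambda>j. f j (single I M i x j)) {i}"
      using that single_carrier[OF that] by (intro h_eq) (auto simp: supp_def single_def)
    also have "\<dots> = f i x"
      using that HomD(1)[OF f] by (simp add: single_def)
    finally show ?thesis
      using single_carrier[OF that] by simp
  qed
  ultimately show thesis
    using that by blast
qed

end

lemma (in universe) two_points:
  obtains a b :: 'u where "a \<noteq> b" "{a, b} \<in> U"
proof -
  obtain N where N: "N \<in> U" "infinite N"
    using infinity by blast
  obtain a where a: "a \<in> N"
    using N(2) by fastforce
  obtain b where b: "b \<in> N" "b \<noteq> a"
    using infinite_remove[OF N(2), of a] by (metis Diff_iff finite.emptyI insertI1 ex_in_conv)
  then show thesis
    using that[of a b] subset_closed[OF N(1), of "{a, b}"] a by auto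
qed

lemma (in universe) Un_closed:
  assumes "A \<in> U" "B \<in> U"
  shows "A \<union> B \<in> U"
proof -
  obtain a b :: 'u where "a \<noteq> b" "{a, b} \<in> U"
    by (rule two_points)
  then show ?thesis
    using Union_closed[of "{a, b}" "\<lambda>i. if i = a then A else B"] assms by (simp add: Un_commute split: if_splits)
qed

text \<open>An element of the direct sum is determined by the graph of its restriction to its support, a
  finite subset of \<open>W \<times> W\<close> for a suitable infinite member \<open>W\<close> of the universe, and \<open>W\<close> has as many
  elements as there are such subsets.\<close>

lemma (in universe) direct_sum_embedding:
  assumes I: "I \<in> U" and M: "\<And>i. i \<in> I \<Longrightarrow> carrier (M i) \<in> U"
  obtains \<phi> :: "('u \<Rightarrow> 'u) \<Rightarrow> 'u"
  where "inj_on \<phi> (carrier (direct_sum I M))" "\<phi> ` carrier (direct_sum I M) \<in> U"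
proof -
  obtain N where N: "N \<in> U" "infinite N"
    using infinity by blast
  define W where "W = I \<union> (\<Union>i\<in>I. carrier (M i)) \<union> N"
  have W: "W \<in> U"
    unfolding W_def by (intro Un_closed I Union_closed M N(1))
  have inf: "infinite W"
    using N(2) by (simp add: W_def)
  then have "infinite (W \<times> W)"
    by (auto simp: finite_cartesian_product_iff)
  then have "Fpow (W \<times> W) \<approx> W \<times> W"
    by (rule eqpoll_Fpow)
  also have "W \<times> W \<approx> W"
    using inf by (simp add: eqpoll_iff_card_of_ordIso card_of_Times_same_infinite)
  finally have "Fpow (W \<times> W) \<lesssim> W"
    by (rule eqpoll_imp_lepoll)
  then obtain \<psi> where \<psi>: "inj_on \<psi> (Fpow (W \<times> W))" "\<psi> ` Fpow (W \<times> W) \<subseteq> W"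
    unfolding lepoll_def by blast
  define graph where "graph x = (\<lambda>i. (i, x i)) ` {i \<in> I. x i \<noteq> \<zero>\<^bsub>M i\<^esub>}" for x
  have graph_iff: "(i, v) \<in> graph x \<longleftrightarrow> i \<in> I \<and> x i = v \<and> v \<noteq> \<zero>\<^bsub>M i\<^esub>" for i v x
    by (auto simp: graph_def)
  have "graph x \<in> Fpow (W \<times> W)" if "x \<in> carrier (direct_sum I M)" for x
    using that by (auto simp: Fpow_def graph_def direct_sum_carrier W_def)
  then have graph: "graph ` carrier (direct_sum I M) \<subseteq> Fpow (W \<times> W)"
    by blast
  have "inj_on graph (carrier (direct_sum I M))"
  proof (rule inj_onI)
    fix x y assume xy: "x \<in> carrier (direct_sum I M)" "y \<in> carrier (direct_sum I M)" "graph x = graph y"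
    show "x = y"
    proof (rule extensionalityI)
      show "x i = y i" if "i \<in> I" for i
        using that xy(3) graph_iff[of i _ x] graph_iff[of i _ y] by metis
    qed (use xy in \<open>simp_all add: direct_sum_carrier\<close>)
  qed
  then have "inj_on (\<psi> \<circ> graph) (carrier (direct_sum I M))"
    using comp_inj_on inj_on_subset[OF \<psi>(1) graph] by blast
  moreover have "(\<psi> \<circ> graph) ` carrier (direct_sum I M) \<in> U"
  proof (rule subset_closed[OF W])
    show "(\<psi> \<circ> graph) ` carrier (direct_sum I M) \<subseteq> W"
      using \<psi>(2) graph by fastforce
  qed
  ultimately show thesis
    by (rule that)
qed

locale module_universe = R?: ring R + U?: universe U
  for R :: "('r, 'x) ring_scheme" and U :: "'u set set" +
  assumes small_ring: "\<exists>\<iota> :: 'r \<Rightarrow> 'u. inj_on \<iota> (carrier R) \<and> \<iota> ` carrier R \<in> U"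
begin

abbreviation "Mods \<equiv> right_modules R U"

text \<open>The module of functions \<open>direct_sum I M\<close> lives on another type and so does not belong to the
  category; its copies inside the universe do, and are the coproducts there.\<close>

definition is_coproduct ::
    "'u set \<Rightarrow> ('u \<Rightarrow> ('r, 'u) module) \<Rightarrow> ('r, 'u) module \<Rightarrow> ('u \<Rightarrow> 'u \<Rightarrow> 'u) \<Rightarrow> bool" where
  "is_coproduct I M S \<kappa> \<longleftrightarrow> S \<in> Mods \<and> (\<forall>i\<in>I. \<kappa> i \<in> Hom R (M i) S) \<and>
     (\<forall>N\<in>Mods. \<forall>f. (\<forall>i\<in>I. f i \<in> Hom R (M i) N) \<longrightarrow>
        (\<exists>h\<in>Hom R S N. \<forall>i\<in>I. \<forall>x\<in>carrier (M i). h (\<kappa> i x) = f i x)) \<and>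
     (\<forall>N\<in>Mods. \<forall>g\<in>Hom R S N. \<forall>h\<in>Hom R S N.
        (\<forall>i\<in>I. \<forall>x\<in>carrier (M i). g (\<kappa> i x) = h (\<kappa> i x)) \<longrightarrow> g = h)"

lemma coproduct_in_Mods: "is_coproduct I M S \<kappa> \<Longrightarrow> S \<in> Mods"
  by (simp add: is_coproduct_def)

lemma coproduct_injection: "\<lbrakk>is_coproduct I M S \<kappa>; i \<in> I\<rbrakk> \<Longrightarrow> \<kappa> i \<in> Hom R (M i) S"
  by (simp add: is_coproduct_def)

lemma coproduct_copair:
  assumes "is_coproduct I M S \<kappa>" "N \<in> Mods" "\<And>i. i \<in> I \<Longrightarrow> f i \<in> Hom R (M i) N"
  obtains h where "h \<in> Hom R S N" "\<And>i x. \<lbrakk>i \<in> I; x \<in> carrier (M i)\<rbrakk> \<Longrightarrow> h (\<kappa> i x) = f i x"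
proof -
  have "\<exists>h\<in>Hom R S N. \<forall>i\<in>I. \<forall>x\<in>carrier (M i). h (\<kappa> i x) = f i x"
    using assms by (simp add: is_coproduct_def)
  then show thesis
    using that by metis
qed

lemma coproduct_eqI:
  assumes "is_coproduct I M S \<kappa>" "N \<in> Mods" "g \<in> Hom R S N" "h \<in> Hom R S N"
    and "\<And>i x. \<lbrakk>i \<in> I; x \<in> carrier (M i)\<rbrakk> \<Longrightarrow> g (\<kappa> i x) = h (\<kappa> i x)"
  shows "g = h"
  using assms by (simp add: is_coproduct_def)

lemma coproduct_exists:
  assumes I: "I \<in> U" and M: "\<And>i. i \<in> I \<Longrightarrow> M i \<in> Mods"
  obtains S \<kappa> \<theta> where "is_coproduct I M S \<kappa>" "\<theta> \<in> Iso R (direct_sum I M) S"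
proof -
  let ?D = "direct_sum I M"
  interpret module_family R I M
    by (intro module_family.intro R.ring_axioms right_modulesD(1)[OF M])
  obtain \<phi> :: "('u \<Rightarrow> 'u) \<Rightarrow> 'u" where "inj_on \<phi> (carrier ?D)" "\<phi> ` carrier ?D \<in> U"
    by (rule direct_sum_embedding[OF I right_modulesD(2)[OF M]])
  then obtain S \<theta> where S: "S \<in> Mods" and \<theta>: "\<theta> \<in> Iso R ?D S"
    by (rule transport_module[OF direct_sum_right_module])
  note modS = right_modulesD(1)[OF S] and \<theta>_epi = Iso_imp_Epi[OF \<theta>]
  note \<theta>_hom = EpiD(1)[OF \<theta>_epi]
  define \<kappa> where "\<kappa> i = compose (carrier (M i)) \<theta> (\<lambda>x\<in>carrier (M i). single I M i x)" for i
  have \<kappa>: "\<kappa> i \<in> Hom R (M i) S" if "i \<in> I" for i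
    unfolding \<kappa>_def using that by (intro Hom_compose[OF mods Hom_single \<theta>_hom])
  have \<kappa>_eq: "\<kappa> i x = \<theta> (single I M i x)" if "x \<in> carrier (M i)" for i x
    using that by (simp add: \<kappa>_def compose_def)
  have ex: "\<exists>h\<in>Hom R S N. \<forall>i\<in>I. \<forall>x\<in>carrier (M i). h (\<kappa> i x) = f i x"
    if N: "N \<in> Mods" and f: "\<forall>i\<in>I. f i \<in> Hom R (M i) N" for N f
  proof -
    note modN = right_modulesD(1)[OF N]
    obtain g where g: "g \<in> Hom R ?D N" "\<And>i x. \<lbrakk>i \<in> I; x \<in> carrier (M i)\<rbrakk> \<Longrightarrow> g (single I M i x) = f i x"
      by (rule direct_sum_copair[OF modN, of f]) (simp add: f, rule that)
    obtain h where h: "h \<in> Hom R S N" "\<And>x. x \<in> carrier ?D \<Longrightarrow> h (\<theta> x) = g x"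
      by (rule Hom_factor_Iso[OF direct_sum_right_module modS modN \<theta> g(1)]) (rule that)
    then show ?thesis
      using g(2) \<kappa>_eq single_carrier by (intro bexI[of _ h] ballI h(1)) simp
  qed
  have eq: "g = h"
    if N: "N \<in> Mods" and gh: "g \<in> Hom R S N" "h \<in> Hom R S N"
      and agree: "\<forall>i\<in>I. \<forall>x\<in>carrier (M i). g (\<kappa> i x) = h (\<kappa> i x)" for N g h
  proof -
    have cong: "compose (carrier ?D) g \<theta> = compose (carrier ?D) h \<theta>"
      by (rule direct_sum_hom_eqI[OF right_modulesD(1)[OF N]
            Hom_compose[OF direct_sum_right_module \<theta>_hom gh(1)]
            Hom_compose[OF direct_sum_right_module \<theta>_hom gh(2)]])
        (use agree in \<open>simp add: compose_def single_carrier \<kappa>_eq\<close>)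
    have *: "g (\<theta> x) = h (\<theta> x)" if "x \<in> carrier ?D" for x
      using fun_cong[OF cong, of x] that by (simp add: compose_eq)
    show ?thesis
    proof (rule Hom_eqI[OF gh])
      fix y assume "y \<in> carrier S"
      then obtain x where "x \<in> carrier ?D" "\<theta> x = y"
        by (rule Epi_surjE[OF \<theta>_epi])
      then show "g y = h y"
        using * by blast
    qed
  qed
  have "is_coproduct I M S \<kappa>"
    unfolding is_coproduct_def
    by (intro conjI ballI allI impI) (fact S, erule \<kappa>, (rule ex; assumption), (rule eq; assumption))
  then show thesis
    using \<theta> by (rule that)
qed

lemma projectiveI:
  assumes "P \<in> Mods"
    and "\<And>M N g f. \<lbrakk>M \<in> Mods; N \<in> Mods; g \<in> Epi R M N; f \<in> Hom R P N\<rbrakk>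
      \<Longrightarrow> \<exists>h\<in>Hom R P M. \<forall>x\<in>carrier P. g (h x) = f x"
  shows "projective R U P"
  unfolding projective_def
proof (intro conjI ballI assms(1))
  fix M N g f
  assume MN: "M \<in> Mods" "N \<in> Mods" "g \<in> Epi R M N" "f \<in> Hom R P N"
  then obtain h where h: "h \<in> Hom R P M" "\<forall>x\<in>carrier P. g (h x) = f x"
    using assms(2) by blast
  have "compose (carrier P) g h = f"
    by (rule Hom_eqI[OF Hom_compose[OF _ h(1) EpiD(1)[OF MN(3)]] MN(4)])
      (use assms(1) h(2) in \<open>auto simp: compose_def dest: right_modulesD\<close>)
  then show "\<exists>h\<in>Hom R P M. compose (carrier P) g h = f"
    using h(1) by blast
qed

lemma projective_in_Mods: "projective R U P \<Longrightarrow> P \<in> Mods"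
  by (simp add: projective_def)

lemma projective_lift:
  assumes "projective R U P" "M \<in> Mods" "N \<in> Mods" "g \<in> Epi R M N" "f \<in> Hom R P N"
  obtains h where "h \<in> Hom R P M" "\<And>x. x \<in> carrier P \<Longrightarrow> g (h x) = f x"
proof -
  obtain h where "h \<in> Hom R P M" "compose (carrier P) g h = f"
    using assms unfolding projective_def by blast
  then show thesis
    by (intro that[of h] compose_eqD) assumption
qed

lemma projective_coproduct:
  assumes S: "is_coproduct I P S \<kappa>" and P: "\<And>i. i \<in> I \<Longrightarrow> projective R U (P i)"
  shows "projective R U S"
proof (rule projectiveI)
  show SM: "S \<in> Mods"
    using S by (rule coproduct_in_Mods)
  note \<kappa> = coproduct_injection[OF S]
  fix M N g f
  assume MN: "M \<in> Mods" "N \<in> Mods" and g: "g \<in> Epi R M N" and f: "f \<in> Hom R S N"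
  have "\<exists>h\<in>Hom R (P i) M. \<forall>x\<in>carrier (P i). g (h x) = f (\<kappa> i x)" if i: "i \<in> I" for i
  proof -
    note modP = right_modulesD(1)[OF projective_in_Mods[OF P[OF i]]]
    obtain h where "h \<in> Hom R (P i) M" "\<And>x. x \<in> carrier (P i) \<Longrightarrow> g (h x) = compose (carrier (P i)) f (\<kappa> i) x"
      by (rule projective_lift[OF P[OF i] MN g Hom_compose[OF modP \<kappa>[OF i] f]]) (rule that)
    then show ?thesis
      by (intro bexI[of _ h]) (auto simp: compose_eq)
  qed
  then obtain h where h: "\<And>i. i \<in> I \<Longrightarrow> h i \<in> Hom R (P i) M"
    "\<And>i x. \<lbrakk>i \<in> I; x \<in> carrier (P i)\<rbrakk> \<Longrightarrow> g (h i x) = f (\<kappa> i x)"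
    by metis
  obtain k where k: "k \<in> Hom R S M" "\<And>i x. \<lbrakk>i \<in> I; x \<in> carrier (P i)\<rbrakk> \<Longrightarrow> k (\<kappa> i x) = h i x"
    by (rule coproduct_copair[OF S MN(1), of h]) (rule h(1), assumption, rule that)
  have gk: "compose (carrier S) g k \<in> Hom R S N"
    by (rule Hom_compose[OF right_modulesD(1)[OF SM] k(1) EpiD(1)[OF g]])
  have "compose (carrier S) g k (\<kappa> i x) = f (\<kappa> i x)" if "i \<in> I" "x \<in> carrier (P i)" for i x
    using that h(2) k(2) HomD(1)[OF \<kappa>] by (simp add: compose_eq)
  then have "compose (carrier S) g k = f"
    by (rule coproduct_eqI[OF S MN(2) gk f])
  then show "\<exists>h\<in>Hom R S M. \<forall>x\<in>carrier S. g (h x) = f x"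
    using k(1) compose_eqD[of "carrier S" g k f] by blast
qed

lemma regular_right_module: "right_module R (regular_module R)"
proof -
  have "abelian_group (regular_module R)"
  proof (rule abelian_groupI)
    show "\<exists>y\<in>carrier (regular_module R). y \<oplus>\<^bsub>regular_module R\<^esub> x = \<zero>\<^bsub>regular_module R\<^esub>"
      if "x \<in> carrier (regular_module R)" for x
      using that by (intro bexI[of _ "\<ominus>\<^bsub>R\<^esub> x"]) (auto simp: regular_module_def R.l_neg)
  qed (auto simp: regular_module_def R.a_ac)
  then show ?thesis
    by (intro right_module.intro right_module_axioms.intro R.ring_axioms)
      (auto simp: regular_module_def R.r_distr R.l_distr R.m_assoc)
qed

lemma Hom_regular:
  assumes N: "right_module R N" and x: "x \<in> carrier N"
  shows "(\<lambda>a\<in>carrier R. a \<odot>\<^bsub>N\<^esub> x) \<in> Hom R (regular_module R) N"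
proof -
  interpret N: right_module R N by fact
  have "(\<lambda>a\<in>carrier (regular_module R). a \<odot>\<^bsub>N\<^esub> x) \<in> Hom R (regular_module R) N"
    by (rule Hom_restrictI[OF regular_right_module])
      (use x in \<open>auto simp: regular_module_def N.smult_closed N.smult_l_distr N.smult_assoc\<close>)
  then show ?thesis
    by (simp add: regular_module_def)
qed

lemma Hom_regular_eqI:
  assumes "f \<in> Hom R (regular_module R) N" "g \<in> Hom R (regular_module R) N" "f \<one>\<^bsub>R\<^esub> = g \<one>\<^bsub>R\<^esub>"
  shows "f = g"
proof (rule Hom_eqI[OF assms(1,2)])
  fix a assume a: "a \<in> carrier (regular_module R)"
  have *: "h a = a \<odot>\<^bsub>N\<^esub> h \<one>\<^bsub>R\<^esub>" if "h \<in> Hom R (regular_module R) N" for h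
    using HomD(3)[OF that, of a "\<one>\<^bsub>R\<^esub>"] a by (simp add: regular_module_def)
  show "f a = g a"
    using *[OF assms(1)] *[OF assms(2)] assms(3) by simp
qed

text \<open>The small copies of the regular module, with \<open>e\<close> in the role of the unit, described by the
  representability of the underlying set functor.\<close>

definition free_on :: "('r, 'u) module \<Rightarrow> 'u \<Rightarrow> bool" where
  "free_on F e \<longleftrightarrow> F \<in> Mods \<and> e \<in> carrier F \<and>
     (\<forall>N\<in>Mods. \<forall>x\<in>carrier N. \<exists>f\<in>Hom R F N. f e = x) \<and>
     (\<forall>N\<in>Mods. \<forall>f\<in>Hom R F N. \<forall>g\<in>Hom R F N. f e = g e \<longrightarrow> f = g)"

lemma free_on_exists:
  obtains F e where "free_on F e"
proof -
  let ?R = "regular_module R"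
  have carrier_R: "carrier ?R = carrier R"
    by (simp add: regular_module_def)
  obtain \<iota> :: "'r \<Rightarrow> 'u" where "inj_on \<iota> (carrier ?R)" "\<iota> ` carrier ?R \<in> U"
    using small_ring by (auto simp: carrier_R)
  then obtain F \<theta> where F: "F \<in> Mods" and \<theta>: "\<theta> \<in> Iso R ?R F"
    by (rule transport_module[OF regular_right_module])
  note modF = right_modulesD(1)[OF F] and \<theta>_epi = Iso_imp_Epi[OF \<theta>]
  note \<theta>_hom = EpiD(1)[OF \<theta>_epi]
  have "\<exists>f\<in>Hom R F N. f (\<theta> \<one>\<^bsub>R\<^esub>) = x" if N: "N \<in> Mods" and x: "x \<in> carrier N" for N x
  proof -
    interpret N: right_module R N using N by (rule right_modulesD)
    let ?f = "\<lambda>a\<in>carrier R. a \<odot>\<^bsub>N\<^esub> x"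
    have f: "?f \<in> Hom R ?R N"
      by (rule Hom_regular[OF N.right_module_axioms x])
    obtain h where "h \<in> Hom R F N" "\<And>a. a \<in> carrier ?R \<Longrightarrow> h (\<theta> a) = ?f a"
      by (rule Hom_factor_Iso[OF regular_right_module modF N.right_module_axioms \<theta> f]) (rule that)
    then show ?thesis
      using x by (intro bexI[of _ h]) (auto simp: carrier_R N.smult_one)
  qed
  moreover have "f = g"
    if fg: "f \<in> Hom R F N" "g \<in> Hom R F N" "f (\<theta> \<one>\<^bsub>R\<^esub>) = g (\<theta> \<one>\<^bsub>R\<^esub>)" for N f g
  proof -
    have cong: "compose (carrier ?R) f \<theta> = compose (carrier ?R) g \<theta>"
      by (rule Hom_regular_eqI[OF Hom_compose[OF regular_right_module \<theta>_hom fg(1)]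
            Hom_compose[OF regular_right_module \<theta>_hom fg(2)]])
        (use fg(3) in \<open>simp add: compose_def carrier_R\<close>)
    have *: "f (\<theta> a) = g (\<theta> a)" if "a \<in> carrier ?R" for a
      using fun_cong[OF cong, of a] that by (simp add: compose_eq)
    show ?thesis
    proof (rule Hom_eqI[OF fg(1,2)])
      fix y assume "y \<in> carrier F"
      then obtain a where "a \<in> carrier ?R" "\<theta> a = y"
        by (rule Epi_surjE[OF \<theta>_epi])
      then show "f y = g y"
        using * by blast
    qed
  qed
  moreover have "\<theta> \<one>\<^bsub>R\<^esub> \<in> carrier F"
    using HomD(1)[OF \<theta>_hom] by (simp add: carrier_R)
  ultimately have "free_on F (\<theta> \<one>\<^bsub>R\<^esub>)"
    unfolding free_on_def using F by blast
  then show thesis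
    by (rule that)
qed

lemma projective_free_on:
  assumes F: "free_on F e"
  shows "projective R U F"
proof (rule projectiveI)
  show FM: "F \<in> Mods"
    using F by (simp add: free_on_def)
  fix M N g f
  assume MN: "M \<in> Mods" "N \<in> Mods" and g: "g \<in> Epi R M N" and f: "f \<in> Hom R F N"
  have e: "e \<in> carrier F"
    using F by (simp add: free_on_def)
  then obtain y where y: "y \<in> carrier M" "g y = f e"
    using HomD(1)[OF f] Epi_surjE[OF g] by blast
  then obtain h where h: "h \<in> Hom R F M" "h e = y"
    using F MN(1) unfolding free_on_def by blast
  have "compose (carrier F) g h \<in> Hom R F N"
    by (rule Hom_compose[OF right_modulesD(1)[OF FM] h(1) EpiD(1)[OF g]])
  moreover have "compose (carrier F) g h e = f e"
    using e h y by (simp add: compose_eq)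
  ultimately have "compose (carrier F) g h = f"
    using F MN(2) f unfolding free_on_def by blast
  then show "\<exists>h\<in>Hom R F M. \<forall>x\<in>carrier F. g (h x) = f x"
    using h(1) compose_eqD[of "carrier F" g h f] by blast
qed

text \<open>The free module on the carrier of \<open>M\<close> is small because its index set is.\<close>

lemma enough_projectives:
  assumes M: "M \<in> Mods"
  obtains P \<pi> where "projective R U P" "\<pi> \<in> Epi R P M"
proof -
  obtain F e where F: "free_on F e"
    by (rule free_on_exists)
  then have FM: "F \<in> Mods" and e: "e \<in> carrier F"
    by (auto simp: free_on_def)
  obtain P \<kappa> where P: "is_coproduct (carrier M) (\<lambda>_. F) P \<kappa>"
    by (rule coproduct_exists[OF right_modulesD(2)[OF M] FM])
  have "\<exists>f\<in>Hom R F M. f e = x" if "x \<in> carrier M" for x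
    using F M that by (auto simp: free_on_def)
  then obtain f where f: "\<And>x. x \<in> carrier M \<Longrightarrow> f x \<in> Hom R F M" "\<And>x. x \<in> carrier M \<Longrightarrow> f x e = x"
    by metis
  obtain \<pi> where \<pi>: "\<pi> \<in> Hom R P M" "\<And>x y. \<lbrakk>x \<in> carrier M; y \<in> carrier F\<rbrakk> \<Longrightarrow> \<pi> (\<kappa> x y) = f x y"
    by (rule coproduct_copair[OF P M, of f]) (rule f(1), assumption, rule that)
  have \<kappa>: "\<kappa> x e \<in> carrier P" if "x \<in> carrier M" for x
    by (rule HomD(1)[OF coproduct_injection[OF P that] e])
  have "x \<in> \<pi> ` carrier P" if "x \<in> carrier M" for x
    using \<pi>(2)[OF that e] f(2)[OF that] \<kappa>[OF that] by (metis imageI)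
  then have "\<pi> \<in> Epi R P M"
    using \<pi>(1) HomD(1)[OF \<pi>(1)] by (auto simp: Epi_def)
  then show thesis
    using that projective_coproduct[OF P] projective_free_on[OF F] by blast
qed

section \<open>Torsion classes and generation\<close>

lemma torsion_class_in_Mods: "torsion_class R U \<T> \<Longrightarrow> X \<in> \<T> \<Longrightarrow> X \<in> Mods"
  unfolding torsion_class_def by (elim conjE) (rule subsetD)

lemma torsion_class_Epi:
  assumes "torsion_class R U \<T>" "M \<in> \<T>" "N \<in> Mods" "g \<in> Epi R M N"
  shows "N \<in> \<T>"
proof -
  have "\<forall>M\<in>\<T>. \<forall>N\<in>Mods. Epi R M N \<noteq> {} \<longrightarrow> N \<in> \<T>"
    using assms(1) unfolding torsion_class_def by (elim conjE)
  then show ?thesis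
    using assms(2-4) by blast
qed

lemma torsion_class_coproduct:
  assumes "torsion_class R U \<T>" "I \<in> U" "\<And>i. i \<in> I \<Longrightarrow> M i \<in> \<T>"
    "S \<in> Mods" "\<theta> \<in> Iso R (direct_sum I M) S"
  shows "S \<in> \<T>"
proof -
  have "\<forall>I\<in>U. \<forall>M :: 'u \<Rightarrow> ('r, 'u) module. (\<forall>i\<in>I. M i \<in> \<T>) \<longrightarrow>
      (\<forall>N\<in>Mods. Iso R (direct_sum I M) N \<noteq> {} \<longrightarrow> N \<in> \<T>)"
    using assms(1) unfolding torsion_class_def by (elim conjE)
  from this[rule_format, OF assms(2), of M, OF assms(3) assms(4)] show ?thesis
    using assms(5) by blast
qed

lemma torsion_class_extension:
  assumes "torsion_class R U \<T>" "L \<in> \<T>" "N \<in> \<T>" "M \<in> Mods" "f \<in> Hom R L M" "g \<in> Epi R M N"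
    "inj_on f (carrier L)" "f ` carrier L = a_kernel M N g"
  shows "M \<in> \<T>"
proof -
  have "\<forall>L\<in>\<T>. \<forall>N\<in>\<T>. \<forall>M\<in>Mods. \<forall>f\<in>Hom R L M. \<forall>g\<in>Epi R M N.
      inj_on f (carrier L) \<and> f ` carrier L = a_kernel M N g \<longrightarrow> M \<in> \<T>"
    using assms(1) unfolding torsion_class_def by (elim conjE)
  from this[rule_format, OF assms(2-6)] show ?thesis
    using assms(7,8) by blast
qed

text \<open>The trace of \<open>T\<close> in \<open>X\<close> is all of \<open>X\<close> once every element is hit; the carrier of \<open>X\<close> is itself
  a small enough index set for the required direct sum.\<close>

lemma GenI:
  assumes X: "X \<in> Mods" and T: "T \<in> Mods"
    and ex: "\<And>x. x \<in> carrier X \<Longrightarrow> \<exists>f\<in>Hom R T X. \<exists>t\<in>carrier T. f t = x"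
  shows "X \<in> Gen R U T"
proof -
  interpret module_family R "carrier X" "\<lambda>_. T"
    by (intro module_family.intro R.ring_axioms right_modulesD(1)[OF T])
  obtain f t where f: "\<And>x. x \<in> carrier X \<Longrightarrow> f x \<in> Hom R T X"
    and t: "\<And>x. x \<in> carrier X \<Longrightarrow> t x \<in> carrier T" "\<And>x. x \<in> carrier X \<Longrightarrow> f x (t x) = x"
    using ex by metis
  obtain h where h: "h \<in> Hom R (direct_sum (carrier X) (\<lambda>_. T)) X"
    "\<And>x y. \<lbrakk>x \<in> carrier X; y \<in> carrier T\<rbrakk> \<Longrightarrow> h (single (carrier X) (\<lambda>_. T) x y) = f x y"
    by (rule direct_sum_copair[OF right_modulesD(1)[OF X], of f]) (simp add: f, rule that)
  have "x \<in> h ` carrier (direct_sum (carrier X) (\<lambda>_. T))" if "x \<in> carrier X" for x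
    using h(2)[OF that t(1)[OF that]] t(2)[OF that] single_carrier[OF that t(1)[OF that]]
    by (metis imageI)
  then have "h \<in> Epi R (direct_sum (carrier X) (\<lambda>_. T)) X"
    using h(1) HomD(1)[OF h(1)] by (auto simp: Epi_def)
  then show ?thesis
    using X right_modulesD(2)[OF X] by (auto simp: Gen_def)
qed

lemma Gen_subset_torsion_class:
  assumes \<T>: "torsion_class R U \<T>" and T: "T \<in> \<T>"
  shows "Gen R U T \<subseteq> \<T>"
proof
  fix X assume "X \<in> Gen R U T"
  then obtain I p where X: "X \<in> Mods" and I: "I \<in> U" and p: "p \<in> Epi R (direct_sum I (\<lambda>_. T)) X"
    by (auto simp: Gen_def)
  let ?D = "direct_sum I (\<lambda>_. T)"
  note TM = torsion_class_in_Mods[OF \<T> T]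
  interpret module_family R I "\<lambda>_. T"
    by (intro module_family.intro R.ring_axioms right_modulesD(1)[OF TM])
  obtain S \<kappa> \<theta> where S: "is_coproduct I (\<lambda>_. T) S \<kappa>" and \<theta>: "\<theta> \<in> Iso R ?D S"
    by (rule coproduct_exists[OF I TM])
  note SM = coproduct_in_Mods[OF S]
  have S\<T>: "S \<in> \<T>"
    by (rule torsion_class_coproduct[OF \<T> I T SM \<theta>])
  note D = direct_sum_right_module
  note modS = right_modulesD(1)[OF SM] and modX = right_modulesD(1)[OF X]
  note \<theta>_epi = Iso_imp_Epi[OF \<theta>]
  obtain g where g: "g \<in> Hom R S X" "\<And>x. x \<in> carrier ?D \<Longrightarrow> g (\<theta> x) = p x"
    by (rule Hom_factor_Iso[OF D modS modX \<theta> EpiD(1)[OF p]]) (rule that)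
  have "y \<in> g ` carrier S" if y: "y \<in> carrier X" for y
  proof -
    obtain x where "x \<in> carrier ?D" "p x = y"
      by (rule Epi_surjE[OF p y])
    then show ?thesis
      using g(2)[of x] HomD(1)[OF EpiD(1)[OF \<theta>_epi], of x] by (metis imageI)
  qed
  then have "g \<in> Epi R S X"
    using g(1) HomD(1)[OF g(1)] by (auto simp: Epi_def)
  then show "X \<in> \<T>"
    by (rule torsion_class_Epi[OF \<T> S\<T> X])
qed

text \<open>The elementwise decomposition stands in for the uniqueness of mediating homomorphisms; it is the
  form in which uniqueness enters computations in quotients of sums.\<close>

definition is_biproduct where
  "is_biproduct A B S i j \<longleftrightarrow> S \<in> Mods \<and> i \<in> Hom R A S \<and> j \<in> Hom R B S \<and>
     (\<forall>N\<in>Mods. \<forall>f\<in>Hom R A N. \<forall>g\<in>Hom R B N.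
        \<exists>h\<in>Hom R S N. (\<forall>x\<in>carrier A. h (i x) = f x) \<and> (\<forall>y\<in>carrier B. h (j y) = g y)) \<and>
     (\<forall>s\<in>carrier S. \<exists>x\<in>carrier A. \<exists>y\<in>carrier B. s = i x \<oplus>\<^bsub>S\<^esub> j y)"

lemma biproductD:
  assumes "is_biproduct A B S i j"
  shows "S \<in> Mods" "i \<in> Hom R A S" "j \<in> Hom R B S"
  using assms by (simp_all add: is_biproduct_def)

lemma biproduct_copair:
  assumes "is_biproduct A B S i j" "N \<in> Mods" "f \<in> Hom R A N" "g \<in> Hom R B N"
  obtains h where "h \<in> Hom R S N" "\<And>x. x \<in> carrier A \<Longrightarrow> h (i x) = f x"
    "\<And>y. y \<in> carrier B \<Longrightarrow> h (j y) = g y"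
proof -
  have "\<exists>h\<in>Hom R S N. (\<forall>x\<in>carrier A. h (i x) = f x) \<and> (\<forall>y\<in>carrier B. h (j y) = g y)"
    using assms by (simp add: is_biproduct_def)
  then show thesis
    using that by blast
qed

lemma biproduct_elem:
  assumes "is_biproduct A B S i j" "s \<in> carrier S"
  obtains x y where "x \<in> carrier A" "y \<in> carrier B" "s = i x \<oplus>\<^bsub>S\<^esub> j y"
  using assms by (auto simp: is_biproduct_def)

lemma biproduct_exists:
  assumes A: "A \<in> Mods" and B: "B \<in> Mods"
  obtains S i j where "is_biproduct A B S i j"
    "\<lbrakk>projective R U A; projective R U B\<rbrakk> \<Longrightarrow> projective R U S"
    "\<And>\<T>. \<lbrakk>torsion_class R U \<T>; A \<in> \<T>; B \<in> \<T>\<rbrakk> \<Longrightarrow> S \<in> \<T>"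
proof -
  obtain a b :: 'u where ab: "a \<noteq> b" "{a, b} \<in> U"
    by (rule two_points)
  let ?I = "{a, b}"
  define M where "M c = (if c = a then A else B)" for c
  have Ma: "M a = A" and Mb: "M b = B"
    using ab(1) by (simp_all add: M_def)
  have MI: "M c \<in> Mods" for c
    using A B by (simp add: M_def)
  obtain S \<kappa> \<theta> where S: "is_coproduct ?I M S \<kappa>" and \<theta>: "\<theta> \<in> Iso R (direct_sum ?I M) S"
    by (rule coproduct_exists[OF ab(2) MI])
  note SM = coproduct_in_Mods[OF S]
  note modS = right_modulesD(1)[OF SM] and modA = right_modulesD(1)[OF A]
    and modB = right_modulesD(1)[OF B]
  have i: "\<kappa> a \<in> Hom R A S" and j: "\<kappa> b \<in> Hom R B S"
    using coproduct_injection[OF S, of a] coproduct_injection[OF S, of b] by (simp_all add: Ma Mb)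
  have copair: "\<exists>h\<in>Hom R S N. (\<forall>x\<in>carrier A. h (\<kappa> a x) = f x) \<and> (\<forall>y\<in>carrier B. h (\<kappa> b y) = g y)"
    if N: "N \<in> Mods" and fg: "f \<in> Hom R A N" "g \<in> Hom R B N" for N f g
  proof -
    have fam: "(if c = a then f else g) \<in> Hom R (M c) N" if "c \<in> ?I" for c
      using fg by (simp add: M_def)
    obtain h where h: "h \<in> Hom R S N"
      "\<And>c x. \<lbrakk>c \<in> ?I; x \<in> carrier (M c)\<rbrakk> \<Longrightarrow> h (\<kappa> c x) = (if c = a then f else g) x"
      by (rule coproduct_copair[OF S N, of "\<lambda>c. if c = a then f else g"]) (rule fam, assumption, rule that)
    show ?thesis
      using h(1) h(2)[of a] h(2)[of b] ab(1) by (intro bexI[of _ h]) (auto simp: Ma Mb)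
  qed
  \<comment> \<open>The idempotents belonging to the two summands add up to the identity.\<close>
  have sum: "\<exists>x\<in>carrier A. \<exists>y\<in>carrier B. s = \<kappa> a x \<oplus>\<^bsub>S\<^esub> \<kappa> b y" if s: "s \<in> carrier S" for s
  proof -
    interpret S: abelian_group S using modS by (rule right_module_abelian_group)
    obtain p where p: "p \<in> Hom R S A" "\<forall>x\<in>carrier A. p (\<kappa> a x) = x" "\<forall>y\<in>carrier B. p (\<kappa> b y) = \<zero>\<^bsub>A\<^esub>"
      using copair[OF A Hom_id[OF modA] Hom_const_zero[OF modB modA]] by auto
    obtain q where q: "q \<in> Hom R S B" "\<forall>x\<in>carrier A. q (\<kappa> a x) = \<zero>\<^bsub>B\<^esub>" "\<forall>y\<in>carrier B. q (\<kappa> b y) = y"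
      using copair[OF B Hom_const_zero[OF modA modB] Hom_id[OF modB]] by auto
    define k where "k = (\<lambda>s\<in>carrier S. compose (carrier S) (\<kappa> a) p s \<oplus>\<^bsub>S\<^esub> compose (carrier S) (\<kappa> b) q s)"
    have k: "k \<in> Hom R S S"
      unfolding k_def
      by (rule Hom_add[OF modS modS Hom_compose[OF modS p(1) i] Hom_compose[OF modS q(1) j]])
    have k_eq: "k s = \<kappa> a (p s) \<oplus>\<^bsub>S\<^esub> \<kappa> b (q s)" if "s \<in> carrier S" for s
      using that by (simp add: k_def compose_eq)
    have "k (\<kappa> c x) = (\<lambda>s\<in>carrier S. s) (\<kappa> c x)" if "c \<in> ?I" "x \<in> carrier (M c)" for c x
    proof (cases "c = a")
      case True
      then have x: "x \<in> carrier A" using that Ma by simp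
      then show ?thesis
        using True p(2) q(2) HomD(1)[OF i x] Hom_zero[OF modB modS j] by (simp add: k_eq)
    next
      case False
      then have c: "c = b" and x: "x \<in> carrier B" using that Mb by auto
      then show ?thesis
        using p(3) q(3) HomD(1)[OF j x] Hom_zero[OF modA modS i] by (simp add: k_eq)
    qed
    then have "k = (\<lambda>s\<in>carrier S. s)"
      by (rule coproduct_eqI[OF S SM k Hom_id[OF modS]])
    then have "s = \<kappa> a (p s) \<oplus>\<^bsub>S\<^esub> \<kappa> b (q s)"
      using s k_eq by (metis restrict_apply')
    then show ?thesis
      using HomD(1)[OF p(1) s] HomD(1)[OF q(1) s] by blast
  qed
  have "is_biproduct A B S (\<kappa> a) (\<kappa> b)"
    unfolding is_biproduct_def using SM i j copair sum by (intro conjI ballI)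
  moreover have "projective R U S" if "projective R U A" "projective R U B"
    by (rule projective_coproduct[OF S]) (simp add: M_def that)
  moreover have "S \<in> \<T>" if "torsion_class R U \<T>" "A \<in> \<T>" "B \<in> \<T>" for \<T>
    by (rule torsion_class_coproduct[OF that(1) ab(2) _ SM \<theta>]) (simp add: M_def that)
  ultimately show thesis
    by (rule that)
qed

lemma mem_D_class_iff:
  assumes P1: "right_module R P1" and \<sigma>: "\<sigma> \<in> Hom R P1 P0"
  shows "X \<in> D_class R U P1 P0 \<sigma> \<longleftrightarrow> X \<in> Mods \<and>
    (\<forall>f\<in>Hom R P1 X. \<exists>g\<in>Hom R P0 X. \<forall>p\<in>carrier P1. g (\<sigma> p) = f p)"
proof -
  have eq: "f = compose (carrier P1) g \<sigma> \<longleftrightarrow> (\<forall>p\<in>carrier P1. g (\<sigma> p) = f p)"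
    if "f \<in> Hom R P1 X" "g \<in> Hom R P0 X" for f g
  proof
    assume "\<forall>p\<in>carrier P1. g (\<sigma> p) = f p"
    then show "f = compose (carrier P1) g \<sigma>"
      by (intro Hom_eqI[OF that(1) Hom_compose[OF P1 \<sigma> that(2)]]) (simp add: compose_eq)
  qed (simp add: compose_eq)
  have sub: "(\<lambda>g. compose (carrier P1) g \<sigma>) ` Hom R P0 X \<subseteq> Hom R P1 X"
    using Hom_compose[OF P1 \<sigma>] by blast
  have "(\<lambda>g. compose (carrier P1) g \<sigma>) ` Hom R P0 X = Hom R P1 X \<longleftrightarrow>
      (\<forall>f\<in>Hom R P1 X. \<exists>g\<in>Hom R P0 X. f = compose (carrier P1) g \<sigma>)"
    using sub by (auto simp: image_iff)
  also have "\<dots> \<longleftrightarrow> (\<forall>f\<in>Hom R P1 X. \<exists>g\<in>Hom R P0 X. \<forall>p\<in>carrier P1. g (\<sigma> p) = f p)"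
    using eq by (intro ball_cong bex_cong refl) auto
  finally show ?thesis
    by (simp add: D_class_def)
qed

section \<open>Splitting extensions of an envelope\<close>

text \<open>An envelope of the regular module, read off at the unit: homomorphisms from \<open>R\<close> correspond to
  elements, so the envelope is a module \<open>M\<close> with a distinguished element \<open>m\<close>.\<close>

definition envelope_at :: "('r, 'u) module set \<Rightarrow> ('r, 'u) module \<Rightarrow> 'u \<Rightarrow> bool" where
  "envelope_at \<T> M m \<longleftrightarrow> M \<in> \<T> \<and> m \<in> carrier M \<and>
     (\<forall>X\<in>\<T>. \<forall>x\<in>carrier X. \<exists>g\<in>Hom R M X. g m = x) \<and>
     (\<forall>\<alpha>\<in>Hom R M M. \<alpha> m = m \<longrightarrow> \<alpha> \<in> Iso R M M)"

text \<open>The module \<open>X\<close> stands for the regular module or a small copy of it, and \<open>e\<close> for its unit; both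
  are described by the correspondence between homomorphisms and elements.\<close>

lemma envelope_at_if_envelope:
  assumes \<T>: "torsion_class R U \<T>" and X: "right_module R X" and e: "e \<in> carrier X"
    and onto: "\<And>N x. \<lbrakk>N \<in> Mods; x \<in> carrier N\<rbrakk> \<Longrightarrow> \<exists>f\<in>Hom R X N. f e = x"
    and eqI: "\<And>N f g. \<lbrakk>N \<in> Mods; f \<in> Hom R X N; g \<in> Hom R X N; f e = g e\<rbrakk> \<Longrightarrow> f = g"
    and env: "envelope R \<T> X M \<epsilon>"
  shows "envelope_at \<T> M (\<epsilon> e)"
proof -
  have M: "M \<in> \<T>" and \<epsilon>: "\<epsilon> \<in> Hom R X M"
    and pre: "\<And>T' f. \<lbrakk>T' \<in> \<T>; f \<in> Hom R X T'\<rbrakk> \<Longrightarrow> \<exists>g\<in>Hom R M T'. compose (carrier X) g \<epsilon> = f"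
    and iso: "\<And>\<alpha>. \<lbrakk>\<alpha> \<in> Hom R M M; compose (carrier X) \<alpha> \<epsilon> = \<epsilon>\<rbrakk> \<Longrightarrow> \<alpha> \<in> Iso R M M"
    using env by (auto simp: envelope_def preenvelope_def)
  have "\<exists>g\<in>Hom R M N. g (\<epsilon> e) = x" if N: "N \<in> \<T>" and x: "x \<in> carrier N" for N x
  proof -
    obtain f where f: "f \<in> Hom R X N" "f e = x"
      using onto[OF torsion_class_in_Mods[OF \<T> N] x] by blast
    obtain g where g: "g \<in> Hom R M N" "compose (carrier X) g \<epsilon> = f"
      using pre[OF N f(1)] by blast
    then show ?thesis
      using compose_eqD[OF g(2) e] f(2) by blast
  qed
  moreover have "\<alpha> \<in> Iso R M M" if \<alpha>: "\<alpha> \<in> Hom R M M" "\<alpha> (\<epsilon> e) = \<epsilon> e" for \<alpha>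
  proof (rule iso[OF \<alpha>(1)])
    show "compose (carrier X) \<alpha> \<epsilon> = \<epsilon>"
      by (rule eqI[OF torsion_class_in_Mods[OF \<T> M] Hom_compose[OF X \<epsilon> \<alpha>(1)] \<epsilon>])
        (use \<alpha>(2) e in \<open>simp add: compose_eq\<close>)
  qed
  ultimately show ?thesis
    unfolding envelope_at_def using M HomD(1)[OF \<epsilon> e] by blast
qed

text \<open>The condition on the kernel of \<open>\<sigma>\<close> makes \<open>X\<close> embed into the pushout \<open>E\<close> of \<open>f\<close> and \<open>\<sigma>\<close>, so that \<open>E\<close>
  is an extension of \<open>M\<close> by \<open>X\<close> and lies in \<open>\<T>\<close>. An element of \<open>E\<close> above \<open>m\<close> gives a map \<open>h : M \<rightarrow> E\<close>
  whose composite with \<open>E \<rightarrow> M\<close> fixes \<open>m\<close>, hence is invertible; the extension splits, and the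
  splitting is the same thing as an extension of \<open>f\<close> along \<open>\<sigma>\<close>.\<close>

lemma Hom_extends_along_presentation:
  assumes \<T>: "torsion_class R U \<T>" and M: "envelope_at \<T> M m"
    and P1: "P1 \<in> Mods" and P0: "P0 \<in> Mods"
    and \<sigma>: "\<sigma> \<in> Hom R P1 P0" and \<pi>: "\<pi> \<in> Epi R P0 M"
    and exact: "\<And>y. y \<in> carrier P0 \<Longrightarrow> \<pi> y = \<zero>\<^bsub>M\<^esub> \<longleftrightarrow> y \<in> \<sigma> ` carrier P1"
    and X: "X \<in> \<T>" and f: "f \<in> Hom R P1 X"
    and ker: "\<And>p. \<lbrakk>p \<in> carrier P1; \<sigma> p = \<zero>\<^bsub>P0\<^esub>\<rbrakk> \<Longrightarrow> f p = \<zero>\<^bsub>X\<^esub>"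
  obtains g where "g \<in> Hom R P0 X" "\<And>p. p \<in> carrier P1 \<Longrightarrow> g (\<sigma> p) = f p"
proof -
  have MT: "M \<in> \<T>" and m: "m \<in> carrier M"
    using M by (auto simp: envelope_at_def)
  note MM = torsion_class_in_Mods[OF \<T> MT] and XM = torsion_class_in_Mods[OF \<T> X]
  note modM = right_modulesD(1)[OF MM] and modX = right_modulesD(1)[OF XM]
    and modP1 = right_modulesD(1)[OF P1] and modP0 = right_modulesD(1)[OF P0]
  note \<pi>H = EpiD(1)[OF \<pi>]
  obtain S i j where S: "is_biproduct X P0 S i j"
    by (rule biproduct_exists[OF XM P0])
  note SM = biproductD(1)[OF S] and i = biproductD(2)[OF S] and j = biproductD(3)[OF S]
  note modS = right_modulesD(1)[OF SM]
  \<comment> \<open>The pushout is the quotient of the direct sum of \<open>X\<close> and \<open>P0\<close> by the image of \<open>d\<close>.\<close>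
  define d where "d = (\<lambda>p\<in>carrier P1. compose (carrier P1) i f p \<ominus>\<^bsub>S\<^esub> compose (carrier P1) j \<sigma> p)"
  have d: "d \<in> Hom R P1 S"
    unfolding d_def
    by (rule Hom_diff[OF modP1 modS Hom_compose[OF modP1 f i] Hom_compose[OF modP1 \<sigma> j]])
  have d_eq: "d p = i (f p) \<ominus>\<^bsub>S\<^esub> j (\<sigma> p)" if "p \<in> carrier P1" for p
    using that by (simp add: d_def compose_eq)
  have "submodule (d ` carrier P1) R S"
    by (rule submodule_image[OF modP1 modS d submodule_carrier[OF modP1]])
  then obtain E c where E: "E \<in> Mods" and c: "c \<in> Epi R S E"
    and c0: "\<And>s. s \<in> carrier S \<Longrightarrow> c s = \<zero>\<^bsub>E\<^esub> \<longleftrightarrow> s \<in> d ` carrier P1"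
    by (rule quotient_module[OF SM]) (rule that)
  note modE = right_modulesD(1)[OF E] and cH = EpiD(1)[OF c]
  define a where "a = compose (carrier X) c i"
  define b where "b = compose (carrier P0) c j"
  have a: "a \<in> Hom R X E" and b: "b \<in> Hom R P0 E"
    unfolding a_def b_def by (rule Hom_compose[OF modX i cH], rule Hom_compose[OF modP0 j cH])
  have a_eq: "a x = c (i x)" if "x \<in> carrier X" for x
    using that by (simp add: a_def compose_eq)
  have b_eq: "b y = c (j y)" if "y \<in> carrier P0" for y
    using that by (simp add: b_def compose_eq)
  have square: "a (f p) = b (\<sigma> p)" if p: "p \<in> carrier P1" for p
  proof -
    have fp: "f p \<in> carrier X" and sp: "\<sigma> p \<in> carrier P0"
      using HomD(1)[OF f p] HomD(1)[OF \<sigma> p] by auto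
    have ifp: "i (f p) \<in> carrier S" and jsp: "j (\<sigma> p) \<in> carrier S"
      using HomD(1)[OF i fp] HomD(1)[OF j sp] by auto
    have "c (d p) = \<zero>\<^bsub>E\<^esub>"
      using c0[OF HomD(1)[OF d p]] p by blast
    then have "c (i (f p)) \<ominus>\<^bsub>E\<^esub> c (j (\<sigma> p)) = \<zero>\<^bsub>E\<^esub>"
      using Hom_minus[OF modS modE cH ifp jsp] d_eq[OF p] by simp
    then show ?thesis
      using minus_eq_zero_iff[OF modE HomD(1)[OF cH ifp] HomD(1)[OF cH jsp]] a_eq[OF fp] b_eq[OF sp]
      by simp
  qed
  \<comment> \<open>The map that is zero on \<open>X\<close> and \<open>\<pi>\<close> on \<open>P0\<close> descends to a projection \<open>\<rho>\<close> of the pushout onto \<open>M\<close>.\<close>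
  obtain r where r: "r \<in> Hom R S M" "\<And>x. x \<in> carrier X \<Longrightarrow> r (i x) = (\<lambda>x\<in>carrier X. \<zero>\<^bsub>M\<^esub>) x"
    "\<And>y. y \<in> carrier P0 \<Longrightarrow> r (j y) = \<pi> y"
    by (rule biproduct_copair[OF S MM Hom_const_zero[OF modX modM] \<pi>H]) (rule that)
  have rd: "r s = \<zero>\<^bsub>M\<^esub>" if s: "s \<in> carrier S" "c s = \<zero>\<^bsub>E\<^esub>" for s
  proof -
    obtain p where p: "p \<in> carrier P1" "s = d p"
      using c0[OF s(1)] s(2) by blast
    have fp: "f p \<in> carrier X" and sp: "\<sigma> p \<in> carrier P0"
      using HomD(1)[OF f p(1)] HomD(1)[OF \<sigma> p(1)] by auto
    have "\<pi> (\<sigma> p) = \<zero>\<^bsub>M\<^esub>"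
      using exact[OF sp] p(1) by blast
    then have "r (i (f p)) = r (j (\<sigma> p))"
      using r(2)[OF fp] r(3)[OF sp] fp by simp
    then have "r (i (f p) \<ominus>\<^bsub>S\<^esub> j (\<sigma> p)) = \<zero>\<^bsub>M\<^esub>"
      using Hom_minus[OF modS modM r(1) HomD(1)[OF i fp] HomD(1)[OF j sp]]
        minus_eq_zero_iff[OF modM] HomD(1)[OF r(1) HomD(1)[OF j sp]] by simp
    then show ?thesis
      using p d_eq by simp
  qed
  obtain \<rho> where \<rho>: "\<rho> \<in> Hom R E M" "\<And>s. s \<in> carrier S \<Longrightarrow> \<rho> (c s) = r s"
    by (rule Hom_factor_Epi[OF modS modE modM c r(1) rd]) (assumption, assumption, rule that)
  have \<rho>a: "\<rho> (a x) = \<zero>\<^bsub>M\<^esub>" if x: "x \<in> carrier X" for x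
    using \<rho>(2)[OF HomD(1)[OF i x]] r(2)[OF x] a_eq[OF x] x by simp
  have \<rho>b: "\<rho> (b y) = \<pi> y" if y: "y \<in> carrier P0" for y
    using \<rho>(2)[OF HomD(1)[OF j y]] r(3)[OF y] b_eq[OF y] by simp
  have "y \<in> \<rho> ` carrier E" if y: "y \<in> carrier M" for y
  proof -
    obtain z where "z \<in> carrier P0" "\<pi> z = y"
      by (rule Epi_surjE[OF \<pi> y])
    then show ?thesis
      using \<rho>b[of z] HomD(1)[OF b, of z] by (metis imageI)
  qed
  then have \<rho>_epi: "\<rho> \<in> Epi R E M"
    using \<rho>(1) HomD(1)[OF \<rho>(1)] by (auto simp: Epi_def)
  have ker_\<rho>: "e \<in> a ` carrier X" if e: "e \<in> carrier E" "\<rho> e = \<zero>\<^bsub>M\<^esub>" for e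
  proof -
    interpret E: abelian_group E using modE by (rule right_module_abelian_group)
    interpret Mg: abelian_group M using modM by (rule right_module_abelian_group)
    interpret Xg: abelian_group X using modX by (rule right_module_abelian_group)
    obtain s where s: "s \<in> carrier S" "c s = e"
      by (rule Epi_surjE[OF c e(1)])
    obtain x y where xy: "x \<in> carrier X" "y \<in> carrier P0" "s = i x \<oplus>\<^bsub>S\<^esub> j y"
      by (rule biproduct_elem[OF S s(1)])
    have e_eq: "e = a x \<oplus>\<^bsub>E\<^esub> b y"
      using s xy HomD(2)[OF cH HomD(1)[OF i xy(1)] HomD(1)[OF j xy(2)]] a_eq[OF xy(1)] b_eq[OF xy(2)]
      by simp
    then have "\<pi> y = \<zero>\<^bsub>M\<^esub>"
      using e(2) HomD(2)[OF \<rho>(1) HomD(1)[OF a xy(1)] HomD(1)[OF b xy(2)]] \<rho>a[OF xy(1)] \<rho>b[OF xy(2)]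
        HomD(1)[OF \<pi>H xy(2)] by simp
    then obtain p where p: "p \<in> carrier P1" "y = \<sigma> p"
      using exact[OF xy(2)] by blast
    have fp: "f p \<in> carrier X"
      by (rule HomD(1)[OF f p(1)])
    have "e = a (x \<oplus>\<^bsub>X\<^esub> f p)"
      using e_eq square[OF p(1)] p(2) HomD(2)[OF a xy(1) fp] by simp
    then show ?thesis
      using xy(1) fp by blast
  qed
  obtain pr where pr: "pr \<in> Hom R S X" "\<And>x. x \<in> carrier X \<Longrightarrow> pr (i x) = (\<lambda>x\<in>carrier X. x) x"
    "\<And>y. y \<in> carrier P0 \<Longrightarrow> pr (j y) = (\<lambda>y\<in>carrier P0. \<zero>\<^bsub>X\<^esub>) y"
    by (rule biproduct_copair[OF S XM Hom_id[OF modX] Hom_const_zero[OF modP0 modX]]) (rule that)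
  obtain pr2 where pr2: "pr2 \<in> Hom R S P0" "\<And>x. x \<in> carrier X \<Longrightarrow> pr2 (i x) = (\<lambda>x\<in>carrier X. \<zero>\<^bsub>P0\<^esub>) x"
    "\<And>y. y \<in> carrier P0 \<Longrightarrow> pr2 (j y) = (\<lambda>y\<in>carrier P0. y) y"
    by (rule biproduct_copair[OF S P0 Hom_const_zero[OF modX modP0] Hom_id[OF modP0]]) (rule that)
  have a_inj: "inj_on a (carrier X)"
    unfolding Hom_inj_iff[OF modX modE a]
  proof (intro ballI impI)
    interpret Xg: abelian_group X using modX by (rule right_module_abelian_group)
    interpret P0g: abelian_group P0 using modP0 by (rule right_module_abelian_group)
    fix x assume x: "x \<in> carrier X" "a x = \<zero>\<^bsub>E\<^esub>"
    then obtain p where p: "p \<in> carrier P1" "i x = d p"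
      using c0[OF HomD(1)[OF i x(1)]] a_eq[OF x(1)] by auto
    have fp: "f p \<in> carrier X" and sp: "\<sigma> p \<in> carrier P0"
      using HomD(1)[OF f p(1)] HomD(1)[OF \<sigma> p(1)] by auto
    have "pr2 (i x) = pr2 (i (f p)) \<ominus>\<^bsub>P0\<^esub> pr2 (j (\<sigma> p))"
      using p d_eq Hom_minus[OF modS modP0 pr2(1) HomD(1)[OF i fp] HomD(1)[OF j sp]] by simp
    then have "\<zero>\<^bsub>P0\<^esub> \<ominus>\<^bsub>P0\<^esub> \<sigma> p = \<zero>\<^bsub>P0\<^esub>"
      using pr2(2)[OF x(1)] pr2(2)[OF fp] pr2(3)[OF sp] x(1) fp sp by simp
    then have "\<sigma> p = \<zero>\<^bsub>P0\<^esub>"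
      using minus_eq_zero_iff[OF modP0 P0g.zero_closed sp] by simp
    then have f0: "f p = \<zero>\<^bsub>X\<^esub>"
      by (rule ker[OF p(1)])
    have "pr (i x) = pr (i (f p)) \<ominus>\<^bsub>X\<^esub> pr (j (\<sigma> p))"
      using p d_eq Hom_minus[OF modS modX pr(1) HomD(1)[OF i fp] HomD(1)[OF j sp]] by simp
    then have "x = f p \<ominus>\<^bsub>X\<^esub> \<zero>\<^bsub>X\<^esub>"
      using pr(2)[OF x(1)] pr(2)[OF fp] pr(3)[OF sp] x(1) fp sp by simp
    then show "x = \<zero>\<^bsub>X\<^esub>"
      using f0 minus_eq_zero_iff[OF modX Xg.zero_closed Xg.zero_closed] by simp
  qed
  have "a ` carrier X = a_kernel E M \<rho>"
    using ker_\<rho> \<rho>a HomD(1)[OF a] by (auto simp: a_kernel_def')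
  then have ET: "E \<in> \<T>"
    by (rule torsion_class_extension[OF \<T> X MT E a \<rho>_epi a_inj])
  \<comment> \<open>Lift \<open>m\<close> to \<open>E\<close>; the envelope turns the lift into a section of \<open>\<rho>\<close> up to an automorphism.\<close>
  obtain e where e: "e \<in> carrier E" "\<rho> e = m"
    by (rule Epi_surjE[OF \<rho>_epi m])
  obtain h where h: "h \<in> Hom R M E" "h m = e"
    using M ET e(1) unfolding envelope_at_def by blast
  have \<alpha>: "compose (carrier M) \<rho> h \<in> Hom R M M"
    by (rule Hom_compose[OF modM h(1) \<rho>(1)])
  have "compose (carrier M) \<rho> h m = m"
    using m h(2) e(2) by (simp add: compose_eq)
  then have "compose (carrier M) \<rho> h \<in> Iso R M M"
    using M \<alpha> unfolding envelope_at_def by blast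
  then have bij: "bij_betw (compose (carrier M) \<rho> h) (carrier M) (carrier M)"
    by (simp add: Iso_def)
  obtain \<beta> where \<beta>: "\<beta> \<in> Hom R M M"
    "\<And>x. x \<in> carrier M \<Longrightarrow> compose (carrier M) \<rho> h (\<beta> x) = (\<lambda>x\<in>carrier M. x) x"
    by (rule Hom_factor_mono[OF modM modM modM \<alpha> _ Hom_id[OF modM]])
      (use bij in \<open>simp_all add: bij_betw_def that\<close>)
  \<comment> \<open>Both \<open>b\<close> and \<open>t\<close> lift \<open>\<pi>\<close> to \<open>E\<close>, and \<open>t\<close> kills the image of \<open>\<sigma>\<close>; so their difference takes
    values in \<open>X\<close> and agrees with \<open>b\<close> on that image.\<close>
  define t where "t = compose (carrier P0) (compose (carrier M) h \<beta>) \<pi>"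
  have t: "t \<in> Hom R P0 E"
    unfolding t_def by (rule Hom_compose[OF modP0 \<pi>H Hom_compose[OF modM \<beta>(1) h(1)]])
  have t_eq: "t y = h (\<beta> (\<pi> y))" if "y \<in> carrier P0" for y
    using that HomD(1)[OF \<pi>H that] by (simp add: t_def compose_eq)
  have \<rho>t: "\<rho> (t y) = \<pi> y" if y: "y \<in> carrier P0" for y
    using \<beta>(2)[OF HomD(1)[OF \<pi>H y]] HomD(1)[OF \<beta>(1) HomD(1)[OF \<pi>H y]] HomD(1)[OF \<pi>H y] t_eq[OF y]
    by (simp add: compose_eq)
  define u where "u = (\<lambda>y\<in>carrier P0. b y \<ominus>\<^bsub>E\<^esub> t y)"
  have u: "u \<in> Hom R P0 E"
    unfolding u_def by (rule Hom_diff[OF modP0 modE b t])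
  have u_im: "u y \<in> a ` carrier X" if y: "y \<in> carrier P0" for y
  proof (rule ker_\<rho>[OF HomD(1)[OF u y]])
    show "\<rho> (u y) = \<zero>\<^bsub>M\<^esub>"
      using y Hom_minus[OF modE modM \<rho>(1) HomD(1)[OF b y] HomD(1)[OF t y]] \<rho>b[OF y] \<rho>t[OF y]
        minus_eq_zero_iff[OF modM HomD(1)[OF \<pi>H y] HomD(1)[OF \<pi>H y]] by (simp add: u_def)
  qed
  obtain g where g: "g \<in> Hom R P0 X" "\<And>y. y \<in> carrier P0 \<Longrightarrow> a (g y) = u y"
    by (rule Hom_factor_mono[OF modX modE modP0 a a_inj u u_im]) (assumption, rule that)
  have "g (\<sigma> p) = f p" if p: "p \<in> carrier P1" for p
  proof (rule inj_onD[OF a_inj])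
    interpret E: abelian_group E using modE by (rule right_module_abelian_group)
    have sp: "\<sigma> p \<in> carrier P0"
      by (rule HomD(1)[OF \<sigma> p])
    show "g (\<sigma> p) \<in> carrier X" "f p \<in> carrier X"
      using HomD(1)[OF g(1) sp] HomD(1)[OF f p] by auto
    have "\<pi> (\<sigma> p) = \<zero>\<^bsub>M\<^esub>"
      using exact[OF sp] p by blast
    then have "t (\<sigma> p) = \<zero>\<^bsub>E\<^esub>"
      using t_eq[OF sp] Hom_zero[OF modM modM \<beta>(1)] Hom_zero[OF modM modE h(1)] by simp
    moreover have "y \<ominus>\<^bsub>E\<^esub> \<zero>\<^bsub>E\<^esub> = y" if "y \<in> carrier E" for y
      using that E.minus_equality[of "\<zero>\<^bsub>E\<^esub>" "\<zero>\<^bsub>E\<^esub>"] by (simp add: a_minus_def)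
    ultimately show "a (g (\<sigma> p)) = a (f p)"
      using g(2)[OF sp] sp square[OF p] HomD(1)[OF b sp] by (simp add: u_def)
  qed
  then show thesis
    using that g(1) by blast
qed

section \<open>Silting modules from envelopes\<close>

lemma submodule_in_Mods:
  assumes "M \<in> Mods" "submodule K R M"
  shows "M\<lparr>carrier := K\<rparr> \<in> Mods"
  using assms right_module_submodule[OF right_modulesD(1)] submoduleD(1) subset_closed
  by (fastforce simp: right_modules_def)

text \<open>This is where the two hypotheses on the ring meet: over a hereditary ring the submodule is
  projective and is its own projective cover, with kernel zero.\<close>

lemma projective_cover_of_submodule:
  assumes R: "right_hereditary R U \<or> right_perfect R U"
    and P: "projective R U P" and K: "submodule K R P"
  obtains P1 \<rho> where "projective_cover R U (P\<lparr>carrier := K\<rparr>) P1 \<rho>"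
proof -
  let ?K = "P\<lparr>carrier := K\<rparr>"
  have KM: "?K \<in> Mods"
    by (rule submodule_in_Mods[OF projective_in_Mods[OF P] K])
  note modK = right_modulesD(1)[OF KM]
  show thesis
    using R
  proof
    assume "right_perfect R U"
    then show thesis
      using KM that unfolding right_perfect_def by blast
  next
    assume "right_hereditary R U"
    then have proj: "projective R U ?K"
      using P K unfolding right_hereditary_def by blast
    interpret Kg: right_module R ?K by fact
    let ?id = "\<lambda>x\<in>carrier ?K. x"
    have "?id \<in> Epi R ?K ?K"
      using Hom_id[OF modK] by (auto simp: Epi_def)
    moreover have ker: "a_kernel ?K ?K ?id = {\<zero>\<^bsub>?K\<^esub>}"
      using Kg.M.zero_closed by (auto simp: a_kernel_def')
    moreover have "superfluous R {\<zero>\<^bsub>?K\<^esub>} ?K"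
      unfolding superfluous_def
    proof (intro conjI allI impI)
      show "submodule {\<zero>\<^bsub>?K\<^esub>} R ?K"
        using submodule_kernel[OF modK modK Hom_id[OF modK]] ker by simp
      fix N assume N: "submodule N R ?K \<and> N <+>\<^bsub>?K\<^esub> {\<zero>\<^bsub>?K\<^esub>} = carrier ?K"
      have "x \<in> N" if "x \<in> carrier ?K" for x
      proof -
        have "x \<in> N <+>\<^bsub>?K\<^esub> {\<zero>\<^bsub>?K\<^esub>}"
          using conjunct2[OF N] that by (rule ssubst)
        then obtain n where n: "n \<in> N" "x = n \<oplus>\<^bsub>?K\<^esub> \<zero>\<^bsub>?K\<^esub>"
          unfolding set_add_def' by blast
        then have "n \<in> carrier ?K"
          using subsetD[OF submoduleD(1)[OF conjunct1[OF N]]] by blast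
        then have "x = n"
          using n(2) Kg.M.r_zero by metis
        then show ?thesis
          using n(1) by simp
      qed
      then have "carrier ?K \<subseteq> N"
        by (rule subsetI)
      with submoduleD(1)[OF conjunct1[OF N]] show "N = carrier ?K"
        by (rule subset_antisym)
    qed
    ultimately have "projective_cover R U ?K ?K ?id"
      using proj by (simp only: projective_cover_def)
    then show thesis
      by (rule that)
  qed
qed

text \<open>Modulo \<open>f(ker \<sigma>)\<close> the map \<open>f\<close> extends along \<open>\<sigma>\<close>, and projectivity of \<open>P0\<close> lifts the extension to a
  map \<open>g : P0 \<rightarrow> X\<close>. The error \<open>d = f - g \<sigma>\<close> takes values in \<open>f(ker \<sigma>)\<close> and equals \<open>f\<close> on
  \<open>ker \<sigma>\<close>; therefore \<open>ker d + ker \<sigma>\<close> is all of \<open>P1\<close>, and \<open>d\<close> vanishes as \<open>ker \<sigma>\<close> is superfluous.\<close>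

lemma torsion_class_subset_D_class:
  assumes \<T>: "torsion_class R U \<T>" and M: "envelope_at \<T> M m"
    and P1: "projective R U P1" and P0: "projective R U P0"
    and \<sigma>: "\<sigma> \<in> Hom R P1 P0" and \<pi>: "\<pi> \<in> Epi R P0 M"
    and exact: "\<And>y. y \<in> carrier P0 \<Longrightarrow> \<pi> y = \<zero>\<^bsub>M\<^esub> \<longleftrightarrow> y \<in> \<sigma> ` carrier P1"
    and small: "superfluous R (a_kernel P1 P0 \<sigma>) P1"
  shows "\<T> \<subseteq> D_class R U P1 P0 \<sigma>"
proof
  fix X assume X: "X \<in> \<T>"
  note P1M = projective_in_Mods[OF P1] and P0M = projective_in_Mods[OF P0]
    and XM = torsion_class_in_Mods[OF \<T> X]
  note modP1 = right_modulesD(1)[OF P1M] and modP0 = right_modulesD(1)[OF P0M]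
    and modX = right_modulesD(1)[OF XM]
  let ?K = "a_kernel P1 P0 \<sigma>"
  have K: "k \<in> carrier P1" "\<sigma> k = \<zero>\<^bsub>P0\<^esub>" if "k \<in> ?K" for k
    using that by (auto simp: a_kernel_def')
  have sub_K: "submodule ?K R P1"
    by (rule submodule_kernel[OF modP1 modP0 \<sigma>])
  have "\<exists>g\<in>Hom R P0 X. \<forall>p\<in>carrier P1. g (\<sigma> p) = f p" if f: "f \<in> Hom R P1 X" for f
  proof -
    have "submodule (f ` ?K) R X"
      by (rule submodule_image[OF modP1 modX f sub_K])
    then obtain Y q where Y: "Y \<in> Mods" and q: "q \<in> Epi R X Y"
      and q0: "\<And>x. x \<in> carrier X \<Longrightarrow> q x = \<zero>\<^bsub>Y\<^esub> \<longleftrightarrow> x \<in> f ` ?K"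
      by (rule quotient_module[OF XM]) (rule that)
    note modY = right_modulesD(1)[OF Y] and qH = EpiD(1)[OF q]
    have YT: "Y \<in> \<T>"
      by (rule torsion_class_Epi[OF \<T> X Y q])
    have qf: "compose (carrier P1) q f \<in> Hom R P1 Y"
      by (rule Hom_compose[OF modP1 f qH])
    have "compose (carrier P1) q f p = \<zero>\<^bsub>Y\<^esub>" if p: "p \<in> carrier P1" "\<sigma> p = \<zero>\<^bsub>P0\<^esub>" for p
    proof -
      have "p \<in> ?K"
        using p by (simp add: a_kernel_def')
      then show ?thesis
        using q0[OF HomD(1)[OF f p(1)]] p(1) by (simp add: compose_eq)
    qed
    from Hom_extends_along_presentation[OF \<T> M P1M P0M \<sigma> \<pi> exact YT qf this]
    obtain g0 where g0: "g0 \<in> Hom R P0 Y"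
      "\<And>p. p \<in> carrier P1 \<Longrightarrow> g0 (\<sigma> p) = compose (carrier P1) q f p"
      by blast
    obtain g where g: "g \<in> Hom R P0 X" "\<And>y. y \<in> carrier P0 \<Longrightarrow> q (g y) = g0 y"
      by (rule projective_lift[OF P0 XM Y q g0(1)]) (rule that)
    define d where "d = (\<lambda>p\<in>carrier P1. f p \<ominus>\<^bsub>X\<^esub> compose (carrier P1) g \<sigma> p)"
    have d: "d \<in> Hom R P1 X"
      unfolding d_def by (rule Hom_diff[OF modP1 modX f Hom_compose[OF modP1 \<sigma> g(1)]])
    have d_eq: "d p = f p \<ominus>\<^bsub>X\<^esub> g (\<sigma> p)" if "p \<in> carrier P1" for p
      using that by (simp add: d_def compose_eq)
    have d_im: "d p \<in> f ` ?K" if p: "p \<in> carrier P1" for p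
    proof -
      have fp: "f p \<in> carrier X" and sp: "\<sigma> p \<in> carrier P0"
        using HomD(1)[OF f p] HomD(1)[OF \<sigma> p] by auto
      have "q (d p) = q (f p) \<ominus>\<^bsub>Y\<^esub> q (g (\<sigma> p))"
        using Hom_minus[OF modX modY qH fp HomD(1)[OF g(1) sp]] d_eq[OF p] by simp
      also have "\<dots> = \<zero>\<^bsub>Y\<^esub>"
        using g(2)[OF sp] g0(2)[OF p] p minus_eq_zero_iff[OF modY HomD(1)[OF qH fp] HomD(1)[OF qH fp]]
        by (simp add: compose_eq)
      finally show ?thesis
        using q0[OF HomD(1)[OF d p]] by simp
    qed
    interpret Xg: abelian_group X using modX by (rule right_module_abelian_group)
    interpret P1g: abelian_group P1 using modP1 by (rule right_module_abelian_group)
    have dK: "d k = f k" if k: "k \<in> ?K" for k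
    proof -
      have "\<ominus>\<^bsub>X\<^esub> \<zero>\<^bsub>X\<^esub> = \<zero>\<^bsub>X\<^esub>"
        by (metis Xg.l_zero Xg.minus_equality Xg.zero_closed)
      then show ?thesis
        using d_eq[OF K(1)[OF k]] K(2)[OF k] Hom_zero[OF modP0 modX g(1)] HomD(1)[OF f K(1)[OF k]]
        by (simp add: a_minus_def)
    qed
    let ?N = "a_kernel P1 X d"
    have "?N <+>\<^bsub>P1\<^esub> ?K = carrier P1"
    proof
      show "?N <+>\<^bsub>P1\<^esub> ?K \<subseteq> carrier P1"
        unfolding set_add_def' by (auto simp: a_kernel_def')
      show "carrier P1 \<subseteq> ?N <+>\<^bsub>P1\<^esub> ?K"
      proof
        fix p assume p: "p \<in> carrier P1"
        obtain k where k: "k \<in> ?K" "d p = d k"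
          using d_im[OF p] dK by force
        have "d (p \<ominus>\<^bsub>P1\<^esub> k) = \<zero>\<^bsub>X\<^esub>"
          using Hom_minus[OF modP1 modX d p K(1)[OF k(1)]] k(2)
            minus_eq_zero_iff[OF modX HomD(1)[OF d p] HomD(1)[OF d K(1)[OF k(1)]]] by simp
        then have "p \<ominus>\<^bsub>P1\<^esub> k \<in> ?N"
          using p K(1)[OF k(1)] by (simp add: a_kernel_def')
        moreover have "p = (p \<ominus>\<^bsub>P1\<^esub> k) \<oplus>\<^bsub>P1\<^esub> k"
          using p K(1)[OF k(1)] by (simp add: a_minus_def P1g.a_assoc P1g.l_neg)
        ultimately show "p \<in> ?N <+>\<^bsub>P1\<^esub> ?K"
          unfolding set_add_def' using k(1) by blast
      qed
    qed
    with submodule_kernel[OF modP1 modX d] have N: "?N = carrier P1"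
      using small[unfolded superfluous_def, THEN conjunct2, THEN spec, THEN mp] by blast
    have "g (\<sigma> p) = f p" if p: "p \<in> carrier P1" for p
    proof -
      have "d p = \<zero>\<^bsub>X\<^esub>"
        using p N by (auto simp: a_kernel_def')
      then show ?thesis
        using d_eq[OF p] minus_eq_zero_iff[OF modX HomD(1)[OF f p] HomD(1)[OF g(1) HomD(1)[OF \<sigma> p]]]
        by simp
    qed
    then show ?thesis
      using g(1) by blast
  qed
  then show "X \<in> D_class R U P1 P0 \<sigma>"
    using mem_D_class_iff[OF modP1 \<sigma>] XM by blast
qed

text \<open>The silting module is the cokernel of a map \<open>\<Sigma>\<close> from the sum of two copies of \<open>P1\<close> and a copy of
  \<open>R\<close> to the sum of two copies of \<open>P0\<close>. The component on \<open>R\<close> forces every member of \<open>D_\<Sigma>\<close> to be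
  generated by \<open>M\<close>; the first copy of \<open>P1 \<rightarrow> P0\<close>, whose target the component on \<open>R\<close> misses, keeps \<open>M\<close> as a direct
  summand of the cokernel, so that it generates \<open>\<T>\<close> too.\<close>

theorem silting_if_envelope_at:
  assumes R: "right_hereditary R U \<or> right_perfect R U"
    and \<T>: "torsion_class R U \<T>" and M: "envelope_at \<T> M m"
  obtains T where "silting R U T" "\<T> = Gen R U T"
proof -
  have MT: "M \<in> \<T>" and m: "m \<in> carrier M"
    and pre: "\<And>X x. \<lbrakk>X \<in> \<T>; x \<in> carrier X\<rbrakk> \<Longrightarrow> \<exists>g\<in>Hom R M X. g m = x"
    using M by (auto simp: envelope_at_def)
  note MM = torsion_class_in_Mods[OF \<T> MT]
  note modM = right_modulesD(1)[OF MM]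
  obtain P0 \<pi> where P0: "projective R U P0" and \<pi>: "\<pi> \<in> Epi R P0 M"
    by (rule enough_projectives[OF MM])
  note P0M = projective_in_Mods[OF P0] and \<pi>H = EpiD(1)[OF \<pi>]
  note modP0 = right_modulesD(1)[OF P0M]
  let ?L = "a_kernel P0 M \<pi>"
  have L: "submodule ?L R P0"
    by (rule submodule_kernel[OF modP0 modM \<pi>H])
  obtain P1 \<sigma> where cover: "projective_cover R U (P0\<lparr>carrier := ?L\<rparr>) P1 \<sigma>"
    by (rule projective_cover_of_submodule[OF R P0 L])
  then have P1: "projective R U P1" and \<sigma>L: "\<sigma> \<in> Epi R P1 (P0\<lparr>carrier := ?L\<rparr>)"
    and small: "superfluous R (a_kernel P1 P0 \<sigma>) P1"
    by (auto simp: projective_cover_def a_kernel_def')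
  note P1M = projective_in_Mods[OF P1]
  note modP1 = right_modulesD(1)[OF P1M]
  have \<sigma>: "\<sigma> \<in> Hom R P1 P0"
    using EpiD(1)[OF \<sigma>L] submoduleD(1)[OF L] by (fastforce simp: Hom_def)
  have \<sigma>_im: "\<sigma> ` carrier P1 = ?L"
    using EpiD(2)[OF \<sigma>L] by simp
  have exact: "\<pi> y = \<zero>\<^bsub>M\<^esub> \<longleftrightarrow> y \<in> \<sigma> ` carrier P1" if "y \<in> carrier P0" for y
    using that \<sigma>_im by (simp add: a_kernel_def')
  have \<pi>\<sigma>: "\<pi> (\<sigma> p) = \<zero>\<^bsub>M\<^esub>" if p: "p \<in> carrier P1" for p
    using exact[OF HomD(1)[OF \<sigma> p]] p by blast
  have sub: "\<T> \<subseteq> D_class R U P1 P0 \<sigma>"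
    by (rule torsion_class_subset_D_class[OF \<T> M P1 P0 \<sigma> \<pi> exact small])
  obtain p0 where p0: "p0 \<in> carrier P0" "\<pi> p0 = m"
    by (rule Epi_surjE[OF \<pi> m])
  obtain F e where F: "free_on F e"
    by (rule free_on_exists)
  have FM: "F \<in> Mods" and e: "e \<in> carrier F"
    and F_ex: "\<And>N x. \<lbrakk>N \<in> Mods; x \<in> carrier N\<rbrakk> \<Longrightarrow> \<exists>f\<in>Hom R F N. f e = x"
    and F_eq: "\<And>N f g. \<lbrakk>N \<in> Mods; f \<in> Hom R F N; g \<in> Hom R F N; f e = g e\<rbrakk> \<Longrightarrow> f = g"
    using F unfolding free_on_def by blast+
  note modF = right_modulesD(1)[OF FM]
  obtain \<eta> where \<eta>: "\<eta> \<in> Hom R F P0" "\<eta> e = p0"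
    using F_ex[OF P0M p0(1)] by blast
  \<comment> \<open>The domain of \<open>\<Sigma>\<close> is the sum \<open>Q1\<close> of \<open>A = P1 \<oplus> P1\<close> and the free module \<open>F\<close> on \<open>e\<close>.\<close>
  obtain Q0 i1 i2 where Q0: "is_biproduct P0 P0 Q0 i1 i2"
    and proj_Q0: "\<lbrakk>projective R U P0; projective R U P0\<rbrakk> \<Longrightarrow> projective R U Q0"
    by (rule biproduct_exists[OF P0M P0M]) (rule that)
  obtain A j1 j2 where A: "is_biproduct P1 P1 A j1 j2"
    and proj_A: "\<lbrakk>projective R U P1; projective R U P1\<rbrakk> \<Longrightarrow> projective R U A"
    by (rule biproduct_exists[OF P1M P1M]) (rule that)
  note Q0M = biproductD(1)[OF Q0] and i1 = biproductD(2)[OF Q0] and i2 = biproductD(3)[OF Q0]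
    and AM = biproductD(1)[OF A] and j1 = biproductD(2)[OF A] and j2 = biproductD(3)[OF A]
  obtain Q1 k1 k2 where Q1: "is_biproduct A F Q1 k1 k2"
    and proj_Q1: "\<lbrakk>projective R U A; projective R U F\<rbrakk> \<Longrightarrow> projective R U Q1"
    by (rule biproduct_exists[OF AM FM]) (rule that)
  note Q1M = biproductD(1)[OF Q1] and k1 = biproductD(2)[OF Q1] and k2 = biproductD(3)[OF Q1]
  note modQ0 = right_modulesD(1)[OF Q0M] and modQ1 = right_modulesD(1)[OF Q1M]
    and modA = right_modulesD(1)[OF AM]
  obtain \<tau> where \<tau>: "\<tau> \<in> Hom R A Q0"
    "\<And>p. p \<in> carrier P1 \<Longrightarrow> \<tau> (j1 p) = compose (carrier P1) i1 \<sigma> p"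
    "\<And>p. p \<in> carrier P1 \<Longrightarrow> \<tau> (j2 p) = compose (carrier P1) i2 \<sigma> p"
    by (rule biproduct_copair[OF A Q0M Hom_compose[OF modP1 \<sigma> i1] Hom_compose[OF modP1 \<sigma> i2]])
      (rule that)
  obtain \<Sigma> where \<Sigma>: "\<Sigma> \<in> Hom R Q1 Q0" "\<And>x. x \<in> carrier A \<Longrightarrow> \<Sigma> (k1 x) = \<tau> x"
    "\<And>y. y \<in> carrier F \<Longrightarrow> \<Sigma> (k2 y) = compose (carrier F) i2 \<eta> y"
    by (rule biproduct_copair[OF Q1 Q0M \<tau>(1) Hom_compose[OF modF \<eta>(1) i2]]) (rule that)
  have \<Sigma>1: "\<Sigma> (k1 (j1 p)) = i1 (\<sigma> p)" if p: "p \<in> carrier P1" for p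
    using \<Sigma>(2)[OF HomD(1)[OF j1 p]] \<tau>(2)[OF p] p by (simp add: compose_eq)
  have \<Sigma>2: "\<Sigma> (k1 (j2 p)) = i2 (\<sigma> p)" if p: "p \<in> carrier P1" for p
    using \<Sigma>(2)[OF HomD(1)[OF j2 p]] \<tau>(3)[OF p] p by (simp add: compose_eq)
  have \<Sigma>3: "\<Sigma> (k2 e) = i2 p0"
    using \<Sigma>(3)[OF e] e \<eta>(2) by (simp add: compose_eq)
  have Q1_eqI: "f = g" if N: "N \<in> Mods" and fg: "f \<in> Hom R Q1 N" "g \<in> Hom R Q1 N"
    and eq1: "\<And>p. p \<in> carrier P1 \<Longrightarrow> f (k1 (j1 p)) = g (k1 (j1 p))"
    and eq2: "\<And>p. p \<in> carrier P1 \<Longrightarrow> f (k1 (j2 p)) = g (k1 (j2 p))"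
    and eq3: "f (k2 e) = g (k2 e)" for N f g
  proof -
    have A_eq: "f (k1 x) = g (k1 x)" if x: "x \<in> carrier A" for x
    proof -
      obtain p q where pq: "p \<in> carrier P1" "q \<in> carrier P1" "x = j1 p \<oplus>\<^bsub>A\<^esub> j2 q"
        by (rule biproduct_elem[OF A x])
      note jp = HomD(1)[OF j1 pq(1)] and jq = HomD(1)[OF j2 pq(2)]
      have split: "h (k1 x) = h (k1 (j1 p)) \<oplus>\<^bsub>N\<^esub> h (k1 (j2 q))" if h: "h \<in> Hom R Q1 N" for h
        using pq(3) HomD(2)[OF k1 jp jq] HomD(2)[OF h HomD(1)[OF k1 jp] HomD(1)[OF k1 jq]] by simp
      show ?thesis
        using split[OF fg(1)] split[OF fg(2)] eq1[OF pq(1)] eq2[OF pq(2)] by simp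
    qed
    have cong: "compose (carrier F) f k2 = compose (carrier F) g k2"
      by (rule F_eq[OF N Hom_compose[OF modF k2 fg(1)] Hom_compose[OF modF k2 fg(2)]])
        (use eq3 e in \<open>simp add: compose_eq\<close>)
    have F_eq': "f (k2 y) = g (k2 y)" if "y \<in> carrier F" for y
      using fun_cong[OF cong, of y] that by (simp add: compose_eq)
    show ?thesis
    proof (rule Hom_eqI[OF fg])
      fix s assume s: "s \<in> carrier Q1"
      obtain x y where xy: "x \<in> carrier A" "y \<in> carrier F" "s = k1 x \<oplus>\<^bsub>Q1\<^esub> k2 y"
        by (rule biproduct_elem[OF Q1 s])
      note kx = HomD(1)[OF k1 xy(1)] and ky = HomD(1)[OF k2 xy(2)]
      show "f s = g s"
        using xy(3) HomD(2)[OF fg(1) kx ky] HomD(2)[OF fg(2) kx ky] A_eq[OF xy(1)] F_eq'[OF xy(2)]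
        by simp
    qed
  qed
  have im: "submodule (\<Sigma> ` carrier Q1) R Q0"
    by (rule submodule_image[OF modQ1 modQ0 \<Sigma>(1) submodule_carrier[OF modQ1]])
  obtain T q where TM: "T \<in> Mods" and q: "q \<in> Epi R Q0 T"
    and q0: "\<And>s. s \<in> carrier Q0 \<Longrightarrow> q s = \<zero>\<^bsub>T\<^esub> \<longleftrightarrow> s \<in> \<Sigma> ` carrier Q1"
    by (rule quotient_module[OF Q0M im]) (rule that)
  note modT = right_modulesD(1)[OF TM] and qH = EpiD(1)[OF q]
  have pres: "projective_presentation R U T Q1 Q0 \<Sigma> q"
    unfolding projective_presentation_def
  proof (intro conjI)
    show "projective R U Q1" "projective R U Q0"
      using proj_Q1 proj_A proj_Q0 P1 P0 projective_free_on[OF F] by blast+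
    show "\<Sigma> ` carrier Q1 = a_kernel Q0 T q"
      using q0 HomD(1)[OF \<Sigma>(1)] by (auto simp: a_kernel_def')
  qed (fact \<Sigma>(1), fact q)
  have TT: "T \<in> \<T>"
  proof -
    have q\<Sigma>: "q (\<Sigma> s) = \<zero>\<^bsub>T\<^esub>" if s: "s \<in> carrier Q1" for s
      using q0[OF HomD(1)[OF \<Sigma>(1) s]] s by blast
    have ker1: "compose (carrier P0) q i1 y = \<zero>\<^bsub>T\<^esub>" if y: "y \<in> carrier P0" "\<pi> y = \<zero>\<^bsub>M\<^esub>" for y
    proof -
      obtain p where p: "p \<in> carrier P1" "y = \<sigma> p"
        using exact[OF y(1)] y(2) by blast
      show ?thesis
        using q\<Sigma>[OF HomD(1)[OF k1 HomD(1)[OF j1 p(1)]]] \<Sigma>1[OF p(1)] y(1) p(2) by (simp add: compose_eq)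
    qed
    have ker2: "compose (carrier P0) q i2 y = \<zero>\<^bsub>T\<^esub>" if y: "y \<in> carrier P0" "\<pi> y = \<zero>\<^bsub>M\<^esub>" for y
    proof -
      obtain p where p: "p \<in> carrier P1" "y = \<sigma> p"
        using exact[OF y(1)] y(2) by blast
      show ?thesis
        using q\<Sigma>[OF HomD(1)[OF k1 HomD(1)[OF j2 p(1)]]] \<Sigma>2[OF p(1)] y(1) p(2) by (simp add: compose_eq)
    qed
    obtain f1 where f1: "f1 \<in> Hom R M T" "\<And>y. y \<in> carrier P0 \<Longrightarrow> f1 (\<pi> y) = compose (carrier P0) q i1 y"
      by (rule Hom_factor_Epi[OF modP0 modM modT \<pi> Hom_compose[OF modP0 i1 qH] ker1])
        (assumption, assumption, rule that)
    obtain f2 where f2: "f2 \<in> Hom R M T" "\<And>y. y \<in> carrier P0 \<Longrightarrow> f2 (\<pi> y) = compose (carrier P0) q i2 y"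
      by (rule Hom_factor_Epi[OF modP0 modM modT \<pi> Hom_compose[OF modP0 i2 qH] ker2])
        (assumption, assumption, rule that)
    obtain B l1 l2 where B: "is_biproduct M M B l1 l2"
      and BT: "\<And>\<T>. \<lbrakk>torsion_class R U \<T>; M \<in> \<T>; M \<in> \<T>\<rbrakk> \<Longrightarrow> B \<in> \<T>"
      by (rule biproduct_exists[OF MM MM]) (rule that)
    note BM = biproductD(1)[OF B] and l1 = biproductD(2)[OF B] and l2 = biproductD(3)[OF B]
    obtain h where h: "h \<in> Hom R B T" "\<And>x. x \<in> carrier M \<Longrightarrow> h (l1 x) = f1 x"
      "\<And>x. x \<in> carrier M \<Longrightarrow> h (l2 x) = f2 x"
      by (rule biproduct_copair[OF B TM f1(1) f2(1)]) (rule that)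
    have "t \<in> h ` carrier B" if t: "t \<in> carrier T" for t
    proof -
      obtain s where s: "s \<in> carrier Q0" "q s = t"
        by (rule Epi_surjE[OF q t])
      obtain x y where xy: "x \<in> carrier P0" "y \<in> carrier P0" "s = i1 x \<oplus>\<^bsub>Q0\<^esub> i2 y"
        by (rule biproduct_elem[OF Q0 s(1)])
      note mx = HomD(1)[OF \<pi>H xy(1)] and my = HomD(1)[OF \<pi>H xy(2)]
      note lx = HomD(1)[OF l1 mx] and ly = HomD(1)[OF l2 my]
      interpret Bg: abelian_group B
        using right_modulesD(1)[OF BM] by (rule right_module_abelian_group)
      have "t = q (i1 x) \<oplus>\<^bsub>T\<^esub> q (i2 y)"
        using s(2) xy(3) HomD(2)[OF qH HomD(1)[OF i1 xy(1)] HomD(1)[OF i2 xy(2)]] by simp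
      also have "\<dots> = h (l1 (\<pi> x)) \<oplus>\<^bsub>T\<^esub> h (l2 (\<pi> y))"
        using h(2)[OF mx] h(3)[OF my] f1(2)[OF xy(1)] f2(2)[OF xy(2)] xy by (simp add: compose_eq)
      also have "\<dots> = h (l1 (\<pi> x) \<oplus>\<^bsub>B\<^esub> l2 (\<pi> y))"
        using HomD(2)[OF h(1) lx ly] by simp
      finally show ?thesis
        using Bg.a_closed[OF lx ly] by blast
    qed
    then have "h \<in> Epi R B T"
      using h(1) HomD(1)[OF h(1)] by (auto simp: Epi_def)
    then show ?thesis
      by (rule torsion_class_Epi[OF \<T> BT[OF \<T> MT MT] TM])
  qed
  have T_D: "X \<in> D_class R U Q1 Q0 \<Sigma>" if X: "X \<in> \<T>" for X
  proof -
    note XM = torsion_class_in_Mods[OF \<T> X]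
    note modX = right_modulesD(1)[OF XM]
    interpret Xg: abelian_group X using modX by (rule right_module_abelian_group)
    have ext: "\<exists>g\<in>Hom R P0 X. \<forall>p\<in>carrier P1. g (\<sigma> p) = f p" if "f \<in> Hom R P1 X" for f
      using subsetD[OF sub X] that mem_D_class_iff[OF modP1 \<sigma>] by blast
    have "\<exists>g\<in>Hom R Q0 X. \<forall>s\<in>carrier Q1. g (\<Sigma> s) = f s" if f: "f \<in> Hom R Q1 X" for f
    proof -
      note fk = Hom_compose[OF modA k1 f]
      obtain g1 where g1: "g1 \<in> Hom R P0 X" "\<forall>p\<in>carrier P1. g1 (\<sigma> p) =
          compose (carrier P1) (compose (carrier A) f k1) j1 p"
        using ext[OF Hom_compose[OF modP1 j1 fk]] by blast
      obtain g2 where g2: "g2 \<in> Hom R P0 X" "\<forall>p\<in>carrier P1. g2 (\<sigma> p) =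
          compose (carrier P1) (compose (carrier A) f k1) j2 p"
        using ext[OF Hom_compose[OF modP1 j2 fk]] by blast
      have fe: "f (k2 e) \<in> carrier X" and gp: "g2 p0 \<in> carrier X"
        using HomD(1)[OF f HomD(1)[OF k2 e]] HomD(1)[OF g2(1) p0(1)] by auto
      obtain h where h: "h \<in> Hom R M X" "h m = f (k2 e) \<ominus>\<^bsub>X\<^esub> g2 p0"
        using pre[OF X Xg.minus_closed[OF fe gp]] by blast
      \<comment> \<open>Adding a map that factors through \<open>\<pi>\<close> changes the value at \<open>p0\<close> without disturbing the
        restriction along \<open>\<sigma>\<close>.\<close>
      define g2' where "g2' = (\<lambda>y\<in>carrier P0. g2 y \<oplus>\<^bsub>X\<^esub> compose (carrier P0) h \<pi> y)"
      have g2': "g2' \<in> Hom R P0 X"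
        unfolding g2'_def by (rule Hom_add[OF modP0 modX g2(1) Hom_compose[OF modP0 \<pi>H h(1)]])
      have g2'_eq: "g2' y = g2 y \<oplus>\<^bsub>X\<^esub> h (\<pi> y)" if "y \<in> carrier P0" for y
        using that by (simp add: g2'_def compose_eq)
      obtain g where g: "g \<in> Hom R Q0 X" "\<And>y. y \<in> carrier P0 \<Longrightarrow> g (i1 y) = g1 y"
        "\<And>y. y \<in> carrier P0 \<Longrightarrow> g (i2 y) = g2' y"
        by (rule biproduct_copair[OF Q0 XM g1(1) g2']) (rule that)
      have "compose (carrier Q1) g \<Sigma> = f"
      proof (rule Q1_eqI[OF XM Hom_compose[OF modQ1 \<Sigma>(1) g(1)] f])
        fix p assume p: "p \<in> carrier P1"
        note sp = HomD(1)[OF \<sigma> p] and jp1 = HomD(1)[OF j1 p] and jp2 = HomD(1)[OF j2 p]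
        show "compose (carrier Q1) g \<Sigma> (k1 (j1 p)) = f (k1 (j1 p))"
          using HomD(1)[OF k1 jp1] g(2)[OF sp] g1(2) p jp1 \<Sigma>1[OF p] by (simp add: compose_eq)
        have "g2' (\<sigma> p) = f (k1 (j2 p))"
          using g2'_eq[OF sp] \<pi>\<sigma>[OF p] Hom_zero[OF modM modX h(1)] g2(2) p jp2
            HomD(1)[OF f HomD(1)[OF k1 jp2]] by (simp add: compose_eq)
        then show "compose (carrier Q1) g \<Sigma> (k1 (j2 p)) = f (k1 (j2 p))"
          using HomD(1)[OF k1 jp2] g(3)[OF sp] \<Sigma>2[OF p] by (simp add: compose_eq)
      next
        have "g2' p0 = f (k2 e)"
          using g2'_eq[OF p0(1)] p0(2) h(2) fe gp
          by (simp add: a_minus_def Xg.a_lcomm[of "g2 p0"] Xg.r_neg)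
        then show "compose (carrier Q1) g \<Sigma> (k2 e) = f (k2 e)"
          using HomD(1)[OF k2 e] g(3)[OF p0(1)] \<Sigma>3 by (simp add: compose_eq)
      qed
      then show ?thesis
        using g(1) compose_eqD[of "carrier Q1" g \<Sigma> f] by blast
    qed
    then show ?thesis
      using mem_D_class_iff[OF modQ1 \<Sigma>(1)] XM by blast
  qed
  have D_Gen: "X \<in> Gen R U T" if X: "X \<in> D_class R U Q1 Q0 \<Sigma>" for X
  proof -
    have XM: "X \<in> Mods"
      and ext: "\<And>f. f \<in> Hom R Q1 X \<Longrightarrow> \<exists>g\<in>Hom R Q0 X. \<forall>s\<in>carrier Q1. g (\<Sigma> s) = f s"
      using X mem_D_class_iff[OF modQ1 \<Sigma>(1)] by blast+
    note modX = right_modulesD(1)[OF XM]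
    show ?thesis
    proof (rule GenI[OF XM TM])
      fix x assume x: "x \<in> carrier X"
      obtain v where v: "v \<in> Hom R F X" "v e = x"
        using F_ex[OF XM x] by blast
      obtain f where f: "f \<in> Hom R Q1 X"
        "\<And>y. y \<in> carrier A \<Longrightarrow> f (k1 y) = (\<lambda>y\<in>carrier A. \<zero>\<^bsub>X\<^esub>) y"
        "\<And>y. y \<in> carrier F \<Longrightarrow> f (k2 y) = v y"
        by (rule biproduct_copair[OF Q1 XM Hom_const_zero[OF modA modX] v(1)]) (rule that)
      obtain g where g: "g \<in> Hom R Q0 X" "\<forall>s\<in>carrier Q1. g (\<Sigma> s) = f s"
        using ext[OF f(1)] by blast
      have g_\<sigma>: "g (i2 (\<sigma> p)) = \<zero>\<^bsub>X\<^esub>" if p: "p \<in> carrier P1" for p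
        using g(2) HomD(1)[OF k1 HomD(1)[OF j2 p]] f(2)[OF HomD(1)[OF j2 p]] HomD(1)[OF j2 p] \<Sigma>2[OF p]
        by (metis restrict_apply')
      have g_p0: "g (i2 p0) = x"
        using g(2) HomD(1)[OF k2 e] f(3)[OF e] v(2) \<Sigma>3 by metis
      \<comment> \<open>The component \<open>g i2\<close> kills \<open>\<sigma>\<close> but not \<open>p0\<close>; moved to the first summand of \<open>Q0\<close>, where only
        \<open>\<sigma>\<close> has to be killed, it factors through \<open>T\<close>.\<close>
      obtain g' where g': "g' \<in> Hom R Q0 X"
        "\<And>y. y \<in> carrier P0 \<Longrightarrow> g' (i1 y) = compose (carrier P0) g i2 y"
        "\<And>y. y \<in> carrier P0 \<Longrightarrow> g' (i2 y) = (\<lambda>y\<in>carrier P0. \<zero>\<^bsub>X\<^esub>) y"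
        by (rule biproduct_copair[OF Q0 XM Hom_compose[OF modP0 i2 g(1)] Hom_const_zero[OF modP0 modX]])
          (rule that)
      have eq0: "compose (carrier Q1) g' \<Sigma> = (\<lambda>s\<in>carrier Q1. \<zero>\<^bsub>X\<^esub>)"
      proof (rule Q1_eqI[OF XM Hom_compose[OF modQ1 \<Sigma>(1) g'(1)] Hom_const_zero[OF modQ1 modX]])
        fix p assume p: "p \<in> carrier P1"
        note sp = HomD(1)[OF \<sigma> p]
        show "compose (carrier Q1) g' \<Sigma> (k1 (j1 p)) = (\<lambda>s\<in>carrier Q1. \<zero>\<^bsub>X\<^esub>) (k1 (j1 p))"
          using HomD(1)[OF k1 HomD(1)[OF j1 p]] g'(2)[OF sp] sp g_\<sigma>[OF p] \<Sigma>1[OF p]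
          by (simp add: compose_eq)
        show "compose (carrier Q1) g' \<Sigma> (k1 (j2 p)) = (\<lambda>s\<in>carrier Q1. \<zero>\<^bsub>X\<^esub>) (k1 (j2 p))"
          using HomD(1)[OF k1 HomD(1)[OF j2 p]] g'(3)[OF sp] sp \<Sigma>2[OF p] by (simp add: compose_eq)
      next
        show "compose (carrier Q1) g' \<Sigma> (k2 e) = (\<lambda>s\<in>carrier Q1. \<zero>\<^bsub>X\<^esub>) (k2 e)"
          using HomD(1)[OF k2 e] g'(3)[OF p0(1)] p0(1) \<Sigma>3 by (simp add: compose_eq)
      qed
      have ker: "g' s = \<zero>\<^bsub>X\<^esub>" if s: "s \<in> carrier Q0" "q s = \<zero>\<^bsub>T\<^esub>" for s
      proof -
        obtain r where r: "r \<in> carrier Q1" "s = \<Sigma> r"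
          using q0[OF s(1)] s(2) by blast
        then show ?thesis
          using compose_eqD[OF eq0 r(1)] by simp
      qed
      obtain u where u: "u \<in> Hom R T X" "\<And>s. s \<in> carrier Q0 \<Longrightarrow> u (q s) = g' s"
        by (rule Hom_factor_Epi[OF modQ0 modT modX q g'(1) ker]) (assumption, assumption, rule that)
      have ip: "i1 p0 \<in> carrier Q0"
        by (rule HomD(1)[OF i1 p0(1)])
      have "u (q (i1 p0)) = x"
        using u(2)[OF ip] g'(2)[OF p0(1)] g_p0 p0(1) by (simp add: compose_eq)
      then show "\<exists>f\<in>Hom R T X. \<exists>t\<in>carrier T. f t = x"
        using u(1) HomD(1)[OF qH ip] by blast
    qed
  qed
  have D: "D_class R U Q1 Q0 \<Sigma> = \<T>" and Gen: "Gen R U T = \<T>"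
    using T_D D_Gen Gen_subset_torsion_class[OF \<T> TT] by blast+
  have "silting R U T"
    unfolding silting_def
  proof (intro conjI exI)
    show "projective_presentation R U T Q1 Q0 \<Sigma> q"
      by (rule pres)
    show "torsion_class R U (D_class R U Q1 Q0 \<Sigma>)"
      using \<T> D by simp
    show "T \<in> D_class R U Q1 Q0 \<Sigma>" "D_class R U Q1 Q0 \<Sigma> = Gen R U T"
      using D Gen TT by simp_all
  qed (rule TM)
  then show thesis
    using that Gen by blast
qed

end

theorem corollary2p12:
  fixes R :: "('r, 'x) ring_scheme" and U :: "'u set set" and \<T> :: "('r, 'u) module set"
  assumes "ring R"
    and "universe U"
    and "\<exists>\<iota> :: 'r \<Rightarrow> 'u. inj_on \<iota> (carrier R) \<and> \<iota> ` carrier R \<in> U"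
    and "right_hereditary R U \<or> right_perfect R U"
    and "torsion_class R U \<T>"
  shows "((\<exists>T. minimal_silting R U T \<and> \<T> = Gen R U T) \<longleftrightarrow>
            (\<exists>M \<epsilon>. envelope R \<T> (regular_module R) M \<epsilon>)) \<and>
         (enveloping R U \<T> \<longrightarrow> (\<exists>T. silting R U T \<and> \<T> = Gen R U T))"
proof -
  interpret module_universe R U
    using assms(1-3) by (intro module_universe.intro module_universe_axioms.intro)
  have regular: "\<exists>T. silting R U T \<and> \<T> = Gen R U T"
    if env: "envelope R \<T> (regular_module R) M \<epsilon>" for M \<epsilon>
  proof -
    have "envelope_at \<T> M (\<epsilon> \<one>\<^bsub>R\<^esub>)"
    proof (rule envelope_at_if_envelope[OF assms(5) regular_right_module _ _ _ env])
      show "\<one>\<^bsub>R\<^esub> \<in> carrier (regular_module R)"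
        by (simp add: regular_module_def)
      show "\<exists>f\<in>Hom R (regular_module R) N. f \<one>\<^bsub>R\<^esub> = x" if N: "N \<in> Mods" "x \<in> carrier N" for N x
        using Hom_regular[OF right_modulesD(1)[OF N(1)] N(2)] N(2)
          right_module.smult_one[OF right_modulesD(1)[OF N(1)] N(2)]
        by (intro bexI[of _ "\<lambda>a\<in>carrier R. a \<odot>\<^bsub>N\<^esub> x"]) auto
    qed (rule Hom_regular_eqI)
    then obtain T where "silting R U T" "\<T> = Gen R U T"
      by (rule silting_if_envelope_at[OF assms(4,5)])
    then show ?thesis
      by blast
  qed
  have "\<exists>T. silting R U T \<and> \<T> = Gen R U T" if "enveloping R U \<T>"
  proof -
    obtain F e where F: "free_on F e"
      by (rule free_on_exists)
    then have FM: "F \<in> Mods"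
      by (simp add: free_on_def)
    then obtain M \<epsilon> where "envelope R \<T> F M \<epsilon>"
      using \<open>enveloping R U \<T>\<close> by (auto simp: enveloping_def)
    then have "envelope_at \<T> M (\<epsilon> e)"
      using F by (intro envelope_at_if_envelope[OF assms(5) right_modulesD(1)[OF FM]])
        (auto simp: free_on_def)
    then obtain T where "silting R U T" "\<T> = Gen R U T"
      by (rule silting_if_envelope_at[OF assms(4,5)])
    then show ?thesis
      by blast
  qed
  moreover have "(\<exists>T. minimal_silting R U T \<and> \<T> = Gen R U T) \<longleftrightarrow>
      (\<exists>M \<epsilon>. envelope R \<T> (regular_module R) M \<epsilon>)"
    using regular unfolding minimal_silting_def by blast
  ultimately show ?thesis
    by blast
qed

end
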